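(* For every sufficiently small $\epsilon>0$ there exists $\delta>0$ such that for all sufficiently large $n$, $$\mathbb{P}\Big(F\big(n^{\frac13+\epsilon}\big) > n^{1-\frac{\epsilon}{2}}\Big) < e^{-n^{\delta}},$$ where $F(r)$ is the number of particles that are outside the interval $[-r,r]$ in the final configuration of the oil and water process on $\mathbb{Z}$ started from $n$ oil and $n$ water particles at the origin.
   Context: Oil and water process. Fix an integer $n\ge 1$ and let $(X^x_k, Y^x_k)_{x\in\mathbb{Z}, k\ge 1}$ be independent random variables, each uniform on $\{+1,-1\}$. For $x\in\mathbb{Z}$ and $t=0,1,2,\dots$ let $\eta_1(x,t)$ and $\eta_2(x,t)$ be the numbers of oil and water particles at $x$ at time $t$. Initially there are $n$ oil and $n$ water particles at the origin and none elsewhere. At time $t$, if some site $x$ has $\min(\eta_1(x,t),\eta_2(x,t))\ge 1$, let $x_t$ be the leftmost (smallest) such site; $x_t$ fires: if this is the $k$-th firing of $x_t$, one oil particle moves from $x_t$ to $x_t+X^{x_t}_k$ and one water particle moves from $x_t$ to $x_t+Y^{x_t}_k$, giving the configuration at time $t+1$. If there is no such site, the process has stopped; let $\tau$ be the first time at which this happens ($\tau$ is almost surely finite). The final configuration is the configuration at time $\tau$. (It does not depend on the order in which legal firings are performed; the leftmost rule is a convention.) For $r>0$, $F(r)=\sum_{x\in\mathbb{Z},\,|x|>r}\big(\eta_1(x,\tau)+\eta_2(x,\tau)\big)$, the total number of particles (of both types) that come to rest outside $[-r,r]$. *)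

theory Defs
  imports "HOL-Probability.Probability"
begin

datatype particle = Oil | Water

text \<open>
  The instruction \<open>\<omega> (p, x, k)\<close> is the displacement of the particle of type \<open>p\<close> moved by the
  \<open>k\<close>-th firing of site \<open>x\<close>, so that \<open>\<omega> (Oil, x, k)\<close> is \<open>X\<^sup>x\<^sub>k\<close> and
  \<open>\<omega> (Water, x, k)\<close> is \<open>Y\<^sup>x\<^sub>k\<close>; firings are numbered from 1.
\<close>

type_synonym instructions = "particle \<times> int \<times> nat \<Rightarrow> int"

definition instruction_indices :: "(particle \<times> int \<times> nat) set" where
  "instruction_indices = UNIV \<times> UNIV \<times> {1..}"

definition instruction_space :: "instructions measure" where
  "instruction_space = (\<Pi>\<^sub>M i\<in>instruction_indices. measure_pmf (pmf_of_set {1, -1}))"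

text \<open>
  Besides the numbers of particles, a state records how often each site has fired so far.
\<close>

record state =
  num :: "particle \<Rightarrow> int \<Rightarrow> nat"
  firings :: "int \<Rightarrow> nat"

definition initial :: "nat \<Rightarrow> state" where
  "initial n = \<lparr>num = (\<lambda>p x. if x = 0 then n else 0), firings = (\<lambda>x. 0)\<rparr>"

definition active :: "state \<Rightarrow> int set" where
  "active s = {x. min (num s Oil x) (num s Water x) \<ge> 1}"

definition fire :: "instructions \<Rightarrow> int \<Rightarrow> state \<Rightarrow> state" where
  "fire \<omega> x s =
     \<lparr>num = (\<lambda>p y. num s p y - of_bool (y = x)
               + of_bool (y = x + \<omega> (p, x, Suc (firings s x)))),
      firings = (firings s)(x := Suc (firings s x))\<rparr>"

definition step :: "instructions \<Rightarrow> state \<Rightarrow> state" where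
  "step \<omega> s = (if active s = {} then s else fire \<omega> (Min (active s)) s)"

definition state_at :: "nat \<Rightarrow> instructions \<Rightarrow> nat \<Rightarrow> state" where
  "state_at n \<omega> t = (step \<omega> ^^ t) (initial n)"

text \<open>
  Almost surely the process stops. On the exceptional null set the stopping time below is an
  unspecified natural number.
\<close>

definition stopping_time :: "nat \<Rightarrow> instructions \<Rightarrow> nat" where
  "stopping_time n \<omega> = (LEAST t. active (state_at n \<omega> t) = {})"

definition final_num :: "nat \<Rightarrow> instructions \<Rightarrow> particle \<Rightarrow> int \<Rightarrow> nat" where
  "final_num n \<omega> = num (state_at n \<omega> (stopping_time n \<omega>))"

text \<open>
  The index set is infinite, whence the unordered infinite sum; all but finitely many terms
  vanish.
\<close>

definition num_outside :: "nat \<Rightarrow> real \<Rightarrow> instructions \<Rightarrow> real" where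
  "num_outside n r \<omega> =
     (\<Sum>\<^sub>\<infinity>x\<in>{x. real_of_int \<bar>x\<bar> > r}. real (final_num n \<omega> Oil x + final_num n \<omega> Water x))"


lemma prob_space_instruction_space: "prob_space instruction_space"
  unfolding instruction_space_def by (intro prob_space_PiM measure_pmf.prob_space_axioms)

lemma distr_instruction:
  assumes "i \<in> instruction_indices"
  shows "distr instruction_space (measure_pmf (pmf_of_set {1, -1})) (\<lambda>\<omega>. \<omega> i)
           = measure_pmf (pmf_of_set {1, -1})"
  unfolding instruction_space_def using assms
  by (intro distr_PiM_component measure_pmf.prob_space_axioms)

lemma indep_vars_instructions:
  "prob_space.indep_vars instruction_space (\<lambda>_. measure_pmf (pmf_of_set {1, -1}))
     (\<lambda>i \<omega>. \<omega> i) instruction_indices"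
proof -
  interpret prob_space instruction_space by (rule prob_space_instruction_space)
  have ne: "instruction_indices \<noteq> {}" by (auto simp: instruction_indices_def)
  have "distr instruction_space instruction_space (\<lambda>\<omega>. \<lambda>i\<in>instruction_indices. \<omega> i)
          = distr instruction_space instruction_space (\<lambda>\<omega>. \<omega>)"
    by (intro distr_cong) (auto simp: instruction_space_def space_PiM PiE_def extensional_restrict)
  also have "\<dots> = instruction_space" by simp
  also have "\<dots> = (\<Pi>\<^sub>M i\<in>instruction_indices. distr instruction_space
                    (measure_pmf (pmf_of_set {1, -1})) (\<lambda>\<omega>. \<omega> i))"
    unfolding instruction_space_def
    by (intro PiM_cong refl) (simp add: distr_instruction[unfolded instruction_space_def])
  finally show ?thesis
    by (subst indep_vars_iff_distr_eq_PiM'[OF ne])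
       (auto simp: instruction_space_def)
qed

lemma finite_support_state_at: "finite {x. num (state_at n \<omega> t) p x \<noteq> 0}"
proof (induction t)
  case 0
  show ?case by (rule finite_subset[of _ "{0}"]) (auto simp: state_at_def initial_def)
next
  case (Suc t)
  define s where "s = state_at n \<omega> t"
  have fire: "finite {y. num (fire \<omega> x s) p y \<noteq> 0}" for x
    by (rule finite_subset[of _ "insert (x + \<omega> (p, x, Suc (firings s x))) {y. num s p y \<noteq> 0}"])
       (use Suc in \<open>auto simp: fire_def s_def\<close>)
  have "state_at n \<omega> (Suc t) = step \<omega> s" by (simp add: state_at_def s_def)
  then show ?case using fire Suc by (auto simp: step_def s_def)
qed

lemma finite_active_state_at: "finite (active (state_at n \<omega> t))"
  by (rule finite_subset[OF _ finite_support_state_at[of n \<omega> t Oil]]) (auto simp: active_def)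

lemma num_outside_eq_sum:
  "num_outside n r \<omega> =
     real (\<Sum>x | real_of_int \<bar>x\<bar> > r \<and> final_num n \<omega> Oil x + final_num n \<omega> Water x \<noteq> 0.
             final_num n \<omega> Oil x + final_num n \<omega> Water x)"
proof -
  let ?A = "{x. real_of_int \<bar>x\<bar> > r \<and> final_num n \<omega> Oil x + final_num n \<omega> Water x \<noteq> 0}"
  have "finite ?A"
    by (rule finite_subset[OF _ finite_UnI[OF finite_support_state_at[of n \<omega> "stopping_time n \<omega>" Oil]
          finite_support_state_at[of n \<omega> "stopping_time n \<omega>" Water]]]) (auto simp: final_num_def)
  moreover have "num_outside n r \<omega> =
      (\<Sum>\<^sub>\<infinity>x\<in>?A. real (final_num n \<omega> Oil x + final_num n \<omega> Water x))"
    unfolding num_outside_def by (rule infsum_cong_neutral) auto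
  ultimately show ?thesis by simp
qed

end

theory Submission
  imports Defs "HOL-Real_Asymp.Real_Asymp"
begin

text \<open>
  Let \<open>u x\<close> be the total number of firings at \<open>x\<close>. The surplus of oil over water at \<open>x\<close> is a
  difference of two random walks, one at \<open>x - 1\<close> stopped at time \<open>u (x - 1)\<close> and one at \<open>x + 1\<close>
  stopped at time \<open>u (x + 1)\<close>, so it is typically of order \<open>sqrt (u x)\<close>. The net flux of particles
  between neighbouring sites is at most \<open>2 n\<close>, which makes \<open>u\<close> vary slowly: on a block of
  \<open>n powr \<epsilon>\<close> sites \<open>u\<close> may be replaced by its value at one endpoint. Hence a union bound over
  polynomially many deterministic times shows that every block on which \<open>u\<close> is at least \<open>v\<close> contains a
  site carrying of order \<open>sqrt v\<close> particles. As there are only \<open>2 n\<close> particles, this first gives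
  \<open>u \<le> n powr (3/2)\<close>. If moreover \<open>M / 2\<close> particles came to rest to the right of
  \<open>R = n powr (1/3 + \<epsilon>)\<close>, then they crossed every edge of \<open>[0, R]\<close>, so \<open>u\<close> drops by at least
  \<open>M / 4\<close> per site there and exceeds \<open>R M / 8\<close> on \<open>[0, R / 2]\<close>; for \<open>M = n powr (1 - \<epsilon>/2)\<close> that
  interval would carry more than \<open>2 n\<close> particles. That the process stops before time \<open>n ^ 3\<close>, so that
  only polynomially many sites and times matter, follows from the sum of the squared surpluses: it
  never exceeds \<open>4 n\<^sup>2\<close> but increases by 1 on average with each firing.
\<close>

section \<open>Conservation laws\<close>

text \<open>Unlike the instruction itself, \<open>coin\<close> takes only the values 1 and -1 everywhere, not just
  almost surely.\<close>

definition coin :: "particle \<times> int \<times> nat \<Rightarrow> instructions \<Rightarrow> real" where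
  "coin i \<omega> = (if \<omega> i = 1 then 1 else -1)"

definition walk :: "instructions \<Rightarrow> particle \<Rightarrow> int \<Rightarrow> nat \<Rightarrow> real" where
  "walk \<omega> p x k = (\<Sum>j=1..k. coin (p, x, j) \<omega>)"

text \<open>Each factor of \<open>instruction_space\<close> has all integers as its space, so
  improper runs form a null set but not an empty one; the deterministic facts are proved off that
  set.\<close>

definition proper :: "instructions \<Rightarrow> bool" where
  "proper \<omega> \<longleftrightarrow> (\<forall>i\<in>instruction_indices. \<omega> i \<in> {1, -1})"

lemma proper_cases:
  assumes "proper \<omega>"
  obtains "\<omega> (p, x, Suc k) = 1" | "\<omega> (p, x, Suc k) = -1"
  using assms by (fastforce simp: proper_def instruction_indices_def)

lemma walk_0 [simp]: "walk \<omega> p x 0 = 0"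
  by (simp add: walk_def)

lemma walk_Suc: "walk \<omega> p x (Suc k) = walk \<omega> p x k + coin (p, x, Suc k) \<omega>"
  by (simp add: walk_def)

lemma state_at_0: "state_at n \<omega> 0 = initial n"
  by (simp add: state_at_def)

lemma state_at_Suc: "state_at n \<omega> (Suc t) = step \<omega> (state_at n \<omega> t)"
  by (simp add: state_at_def)

lemma Min_active:
  assumes "finite (active s)" "active s \<noteq> {}"
  shows "num s p (Min (active s)) \<ge> 1"
  using Min_in[OF assms] by (cases p) (auto simp: active_def)

text \<open>Of the first k instructions for one type at a site, (k + walk)/2 point right and (k -
  walk)/2 left. So \<open>y\<close> receives the former from \<open>y - 1\<close>, the latter from
  \<open>y + 1\<close>, and loses one particle per firing of its own; doubling clears the
  halves.\<close>

lemma num_balance: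
  fixes n :: nat
  assumes "proper \<omega>"
  defines "s \<equiv> state_at n \<omega>"
  shows "2 * real (num (s t) p y) =
    (if y = 0 then 2 * real n else 0) - 2 * real (firings (s t) y)
    + real (firings (s t) (y - 1)) + walk \<omega> p (y - 1) (firings (s t) (y - 1))
    + real (firings (s t) (y + 1)) - walk \<omega> p (y + 1) (firings (s t) (y + 1))"
proof (induction t)
  case 0
  show ?case by (simp add: s_def state_at_0 initial_def)
next
  case (Suc t)
  show ?case
  proof (cases "active (s t) = {}")
    case True
    then show ?thesis using Suc by (simp add: s_def state_at_Suc step_def)
  next
    case False
    define x where "x = Min (active (s t))"
    have s: "s (Suc t) = fire \<omega> x (s t)"
      using False by (simp add: s_def state_at_Suc step_def x_def)
    \<comment> \<open>Rules out truncation in the natural-number subtraction of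
      \<open>fire\<close>.\<close>
    have pos: "num (s t) p x \<ge> 1"
      unfolding x_def s_def by (rule Min_active[OF finite_active_state_at]) (use False s_def in auto)
    consider "x = y" | "x = y - 1" | "x = y + 1" | "x \<noteq> y" "x \<noteq> y - 1" "x \<noteq> y + 1" by blast
    then show ?thesis
    proof cases
      case 1
      then have y: "y = x" by simp
      from assms(1) show ?thesis unfolding s
        by (rule proper_cases[of _ p x "firings (s t) x"])
          (use Suc pos in \<open>simp_all add: y fire_def walk_Suc coin_def of_nat_diff algebra_simps\<close>)
    next
      case 2
      then have y: "y = x + 1" by simp
      from assms(1) show ?thesis unfolding s
        by (rule proper_cases[of _ p x "firings (s t) x"])
          (use Suc pos in \<open>simp_all add: y fire_def walk_Suc coin_def of_nat_diff algebra_simps\<close>)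
    next
      case 3
      then have y: "y = x - 1" by simp
      from assms(1) show ?thesis unfolding s
        by (rule proper_cases[of _ p x "firings (s t) x"])
          (use Suc pos in \<open>simp_all add: y fire_def walk_Suc coin_def of_nat_diff algebra_simps\<close>)
    next
      case 4
      from assms(1) show ?thesis unfolding s
        by (rule proper_cases[of _ p x "firings (s t) x"]) (use 4 Suc in \<open>auto simp: fire_def\<close>)
    qed
  qed
qed

lemma support_state_at:
  assumes "proper \<omega>" "\<bar>x\<bar> > int t"
  shows "num (state_at n \<omega> t) p x = 0" "firings (state_at n \<omega> t) x = 0"
proof -
  have "\<forall>x. \<bar>x\<bar> > int t \<longrightarrow> (\<forall>p. num (state_at n \<omega> t) p x = 0) \<and> firings (state_at n \<omega> t) x = 0"
  proof (induction t)
    case 0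
    show ?case by (simp add: state_at_0 initial_def)
  next
    case (Suc t)
    define s where "s = state_at n \<omega> t"
    show ?case
    proof (cases "active s = {}")
      case True
      then show ?thesis using Suc by (simp add: s_def state_at_Suc step_def)
    next
      case False
      define x where "x = Min (active s)"
      have s: "state_at n \<omega> (Suc t) = fire \<omega> x s"
        using False by (simp add: s_def state_at_Suc step_def x_def)
      have pos: "num s Oil x \<ge> 1"
        unfolding x_def s_def by (rule Min_active[OF finite_active_state_at]) (use False s_def in auto)
      then have x: "\<bar>x\<bar> \<le> int t"
        using Suc unfolding s_def by (metis not_le not_one_le_zero)
      have "num (fire \<omega> x s) p y = 0" if "\<bar>y\<bar> > int (Suc t)" for y p
        using assms(1) by (rule proper_cases[of _ p x "firings s x"])
          (use that x Suc in \<open>auto simp: fire_def s_def\<close>)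
      moreover have "firings (fire \<omega> x s) y = 0" if "\<bar>y\<bar> > int (Suc t)" for y
        using that x Suc by (auto simp: fire_def s_def)
      ultimately show ?thesis unfolding s by blast
    qed
  qed
  then show "num (state_at n \<omega> t) p x = 0" "firings (state_at n \<omega> t) x = 0"
    using assms(2) by auto
qed

lemma firings_le: "firings (state_at n \<omega> t) x \<le> t"
proof (induction t)
  case 0
  show ?case by (simp add: state_at_0 initial_def)
next
  case (Suc t)
  then show ?case by (auto simp: state_at_Suc step_def fire_def le_SucI)
qed

text \<open>A state without active sites is fixed by \<open>step\<close>, so the final configuration
  can be read off at any deterministic time by which the process has stopped.\<close>

lemma final_num_eq:
  assumes "active (state_at n \<omega> T) = {}"
  shows "final_num n \<omega> = num (state_at n \<omega> T)"
proof -
  have *: "state_at n \<omega> (t + k) = state_at n \<omega> t" if "active (state_at n \<omega> t) = {}" for t k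
    by (induction k) (use that in \<open>auto simp: state_at_Suc step_def\<close>)
  let ?t = "stopping_time n \<omega>"
  have "active (state_at n \<omega> ?t) = {}" "?t \<le> T"
    unfolding stopping_time_def by (rule LeastI[of "\<lambda>t. active (state_at n \<omega> t) = {}", OF assms],
      rule Least_le[of "\<lambda>t. active (state_at n \<omega> t) = {}", OF assms])
  with *[of ?t "T - ?t"] show ?thesis
    by (simp add: final_num_def)
qed

section \<open>Mass balance and the flux across edges\<close>

definition mass :: "state \<Rightarrow> int \<Rightarrow> real" where
  "mass s x = real (num s Oil x + num s Water x)"

definition noise :: "instructions \<Rightarrow> state \<Rightarrow> int \<Rightarrow> real" where
  "noise \<omega> s x = (walk \<omega> Oil x (firings s x) + walk \<omega> Water x (firings s x)) / 2"

text \<open>Net number of particles of both types that have crossed from \<open>x\<close> to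
  \<open>x + 1\<close>: firings plus noise at \<open>x\<close> count the jumps to the right, firings
  minus noise at \<open>x + 1\<close> the jumps to the left.\<close>

definition flux :: "instructions \<Rightarrow> state \<Rightarrow> int \<Rightarrow> real" where
  "flux \<omega> s x = real (firings s x) - real (firings s (x + 1)) + noise \<omega> s x + noise \<omega> s (x + 1)"

lemma mass_nonneg: "mass s x \<ge> 0"
  by (simp add: mass_def)

lemma mass_eq_flux_diff:
  fixes n t :: nat
  assumes "proper \<omega>"
  defines "s \<equiv> state_at n \<omega> t"
  shows "mass s y = (if y = 0 then 2 * real n else 0) + flux \<omega> s (y - 1) - flux \<omega> s y"
  using num_balance[OF assms(1), of n t Oil y] num_balance[OF assms(1), of n t Water y]
  unfolding s_def mass_def flux_def noise_def by (simp add: field_simps split: if_splits)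

text \<open>Telescoping of \<open>mass_eq_flux_diff\<close> leftwards from \<open>L\<close>, where
  nothing has fired; the initial particles at 0 enter once \<open>x\<close> is negative.\<close>

lemma sum_mass_right:
  fixes n t :: nat
  assumes "proper \<omega>" "x \<le> L" "L > int t"
  defines "s \<equiv> state_at n \<omega> t"
  shows "(\<Sum>y\<in>{x<..L}. mass s y) = flux \<omega> s x + (if x < 0 then 2 * real n else 0)"
  using assms(2)
proof (induction x rule: int_le_induct)
  case base
  show ?case
    using assms(3) support_state_at(2)[OF assms(1), of t _ n] by (simp add: s_def flux_def noise_def)
next
  case (step x)
  have "{x - 1<..L} = insert x {x<..L}" using step by auto
  then show ?case
    using step mass_eq_flux_diff[OF assms(1), of n t x] by (auto simp: s_def split: if_splits)
qed

lemma sum_mass_total: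
  fixes n t :: nat
  assumes "proper \<omega>" "L > int t"
  defines "s \<equiv> state_at n \<omega> t"
  shows "(\<Sum>y\<in>{-L..L}. mass s y) = 2 * real n"
proof -
  have "{-L..L} = {-L-1<..L}" by auto
  moreover have "flux \<omega> s (-L-1) = 0"
    using assms(2) support_state_at(2)[OF assms(1), of t _ n] by (simp add: s_def flux_def noise_def)
  ultimately show ?thesis
    using sum_mass_right[OF assms(1) _ assms(2), of "-L-1" n] assms(2) by (simp add: s_def)
qed

lemma sum_mass_le:
  assumes "proper \<omega>" "finite I"
  shows "(\<Sum>y\<in>I. mass (state_at n \<omega> t) y) \<le> 2 * real n"
proof -
  define L where "L = int t + 1"
  have "(\<Sum>y\<in>I. mass (state_at n \<omega> t) y) = (\<Sum>y\<in>I \<inter> {-L..L}. mass (state_at n \<omega> t) y)"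
  proof (rule sum.mono_neutral_right[OF assms(2)])
    show "\<forall>i\<in>I - I \<inter> {-L..L}. mass (state_at n \<omega> t) i = 0"
    proof
      fix i assume "i \<in> I - I \<inter> {-L..L}"
      then have "\<bar>i\<bar> > int t" by (auto simp: L_def)
      then show "mass (state_at n \<omega> t) i = 0"
        using support_state_at(1)[OF assms(1)] by (simp add: mass_def)
    qed
  qed auto
  also have "\<dots> \<le> (\<Sum>y\<in>{-L..L}. mass (state_at n \<omega> t) y)"
    by (rule sum_mono2) (auto simp: mass_nonneg)
  finally show ?thesis using sum_mass_total[OF assms(1), of t L n] by (simp add: L_def)
qed

lemma sum_mass_left:
  fixes n t :: nat
  assumes "proper \<omega>" "-L - 1 \<le> x" "x < 0" "L > int t"
  defines "s \<equiv> state_at n \<omega> t"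
  shows "(\<Sum>y\<in>{-L..x}. mass s y) = - flux \<omega> s x"
proof -
  have "{-L..L} = {-L..x} \<union> {x<..L}" using assms by auto
  then have "(\<Sum>y\<in>{-L..L}. mass s y) = (\<Sum>y\<in>{-L..x}. mass s y) + (\<Sum>y\<in>{x<..L}. mass s y)"
    by (simp add: sum.union_disjoint ivl_disj_int)
  then show ?thesis
    using sum_mass_total[OF assms(1,4), of n] sum_mass_right[OF assms(1) _ assms(4), of x n] assms
    by (simp add: s_def)
qed

text \<open>For nonnegative \<open>x\<close> the flux is the mass to the right of the edge, for
  negative \<open>x\<close> minus the mass to its left; neither mass exceeds 2n.\<close>

lemma abs_flux_le:
  assumes "proper \<omega>"
  shows "\<bar>flux \<omega> (state_at n \<omega> t) x\<bar> \<le> 2 * real n"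
proof -
  define L where "L = max (int t) \<bar>x\<bar> + 1"
  have L: "L > int t" "x \<le> L" "-L - 1 \<le> x" by (auto simp: L_def)
  show ?thesis
  proof (cases "x < 0")
    case True
    show ?thesis
      using sum_mass_left[OF assms L(3) True L(1), of n] sum_mass_le[OF assms, of "{-L..x}" n t]
        sum_nonneg[of "{-L..x}" "mass (state_at n \<omega> t)"] by (simp add: mass_nonneg)
  next
    case False
    then show ?thesis
      using sum_mass_right[OF assms L(2,1), of n] sum_mass_le[OF assms, of "{x<..L}" n t]
        sum_nonneg[of "{x<..L}" "mass (state_at n \<omega> t)"] by (simp add: mass_nonneg)
  qed
qed

section \<open>Spreading on a typical run\<close>

text \<open>Twice the surplus of oil over water that would result at \<open>y\<close> if both neighbours of \<open>y\<close> had
  fired exactly \<open>v\<close> times.\<close>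

definition contrast :: "instructions \<Rightarrow> int \<Rightarrow> nat \<Rightarrow> real" where
  "contrast \<omega> y v = (walk \<omega> Oil (y - 1) v - walk \<omega> Oil (y + 1) v)
                   - (walk \<omega> Water (y - 1) v - walk \<omega> Water (y + 1) v)"

text \<open>Gathers what holds with high probability, so that the spreading argument is
  deterministic. Both bounds range over deterministic times and are later applied at the random
  firing counts. The test sites are four apart so that their contrasts read disjoint sets of
  instructions.\<close>

locale typical_run =
  fixes n T b :: nat and \<omega> :: instructions and H :: real
  assumes proper: "proper \<omega>"
    and H_ge_1: "H \<ge> 1"
    and oscillation: "\<And>p x j k. \<bar>x\<bar> \<le> int T \<Longrightarrow> j \<le> k \<Longrightarrow> k \<le> T \<Longrightarrow>
          \<bar>walk \<omega> p x k - walk \<omega> p x j\<bar> \<le> H * sqrt (real k - real j)"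
    and separation: "\<And>x v. \<bar>x\<bar> \<le> int T \<Longrightarrow> 1 \<le> v \<Longrightarrow> v \<le> T \<Longrightarrow>
          \<exists>i<b. \<bar>contrast \<omega> (x + 1 + 4 * int i) v\<bar> \<ge> sqrt (2 * real v)"
begin

definition final :: state where "final = state_at n \<omega> T"

abbreviation u :: "int \<Rightarrow> nat" where "u \<equiv> firings final"

lemma u_le_T: "u x \<le> T"
  by (simp add: final_def firings_le)

lemma site_in_range: "u x > 0 \<Longrightarrow> \<bar>x\<bar> \<le> int T"
  using support_state_at(2)[OF proper, of T x n] by (force simp: final_def)

lemma walk_diff:
  assumes "\<bar>x\<bar> \<le> int T" "j \<le> T" "k \<le> T"
  shows "\<bar>walk \<omega> p x k - walk \<omega> p x j\<bar> \<le> H * sqrt \<bar>real k - real j\<bar>"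
  using oscillation[OF assms(1), of j k p] oscillation[OF assms(1), of k j p] assms
  by (cases "j \<le> k") (simp_all add: abs_minus_commute)

lemma abs_noise_le: "\<bar>noise \<omega> final x\<bar> \<le> H * sqrt (real (u x))"
proof (cases "u x > 0")
  case True
  then have "\<bar>walk \<omega> p x (u x)\<bar> \<le> H * sqrt (real (u x))" for p
    using walk_diff[OF site_in_range, of x 0 "u x" p] by (simp add: u_le_T)
  from this[of Oil] this[of Water] show ?thesis
    unfolding noise_def by (simp add: abs_le_iff)
qed (simp add: noise_def)

lemma abs_flux_final_le: "\<bar>flux \<omega> final x\<bar> \<le> 2 * real n"
  unfolding final_def by (rule abs_flux_le[OF proper])

text \<open>In the surplus of oil over water the firing counts cancel and only walks remain; the
  surplus is at most the mass.\<close>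

lemma mass_ge_contrast:
  "2 * mass final y \<ge> \<bar>(walk \<omega> Oil (y - 1) (u (y - 1)) - walk \<omega> Oil (y + 1) (u (y + 1)))
      - (walk \<omega> Water (y - 1) (u (y - 1)) - walk \<omega> Water (y + 1) (u (y + 1)))\<bar>"
proof -
  have "2 * real (num final Oil y) - 2 * real (num final Water y) =
      (walk \<omega> Oil (y - 1) (u (y - 1)) - walk \<omega> Oil (y + 1) (u (y + 1)))
      - (walk \<omega> Water (y - 1) (u (y - 1)) - walk \<omega> Water (y + 1) (u (y + 1)))"
    unfolding final_def num_balance[OF proper] by simp
  then show ?thesis by (simp add: mass_def abs_le_iff)
qed

section \<open>Slow variation of the firing counts and mass in blocks\<close>

context
  fixes S L v\<^sub>0 :: real and K :: nat
  assumes max: "\<And>x. sqrt (real (u x)) \<le> S"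
    and L: "2 * real n + 2 * H * S \<le> L"
    and K: "K = 4 * b"
begin

text \<open>Solve the definition of \<open>flux\<close> for the difference of firing counts: the
  flux is at most 2n and each noise term at most \<open>H * S\<close>.\<close>

lemma u_step: "\<bar>real (u (x + 1)) - real (u x)\<bar> \<le> L"
proof -
  have "H * sqrt (real (u x)) \<le> H * S" for x
    using max H_ge_1 by (intro mult_left_mono) auto
  from this[of x] this[of "x + 1"] abs_noise_le[of x] abs_noise_le[of "x + 1"]
    abs_flux_final_le[of x] L
  show ?thesis unfolding flux_def by linarith
qed

lemma u_lipschitz: "\<bar>real (u (x + int k)) - real (u x)\<bar> \<le> real k * L"
proof (induction k)
  case (Suc k)
  then show ?case using u_step[of "x + int k"] by (simp add: algebra_simps)
qed simp

lemma L_nonneg: "L \<ge> 0"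
  using u_step[of 0] by linarith

text \<open>On the block all counts are within \<open>K * L\<close> of \<open>u x\<close>, so each
  of the four walks in the surplus at a test site may be evaluated at time \<open>u x\<close> at a
  cost of \<open>H * sqrt (K * L)\<close>. Separation at \<open>v = u x\<close> then leaves a large
  surplus.\<close>

lemma block_mass:
  assumes v: "v\<^sub>0 > 0" "v\<^sub>0 \<ge> 32 * H\<^sup>2 * real K * L"
    and u: "\<And>y. y \<in> {x..<x + int K} \<Longrightarrow> real (u y) \<ge> v\<^sub>0"
    and b: "b > 0"
  shows "\<exists>y\<in>{x..<x + int K}. mass final y \<ge> sqrt (v\<^sub>0 / 8)"
proof -
  have x: "real (u x) \<ge> v\<^sub>0" using u[of x] b K by simp
  then have ux: "u x > 0" using v by (cases "u x") auto
  then obtain i where i: "i < b" "\<bar>contrast \<omega> (x + 1 + 4 * int i) (u x)\<bar> \<ge> sqrt (2 * real (u x))"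
    using separation[OF site_in_range, of x "u x"] u_le_T by auto
  define y where "y = x + 1 + 4 * int i"
  have close: "\<bar>walk \<omega> p z (u z) - walk \<omega> p z (u x)\<bar> \<le> sqrt (v\<^sub>0 / 32)"
    if z: "z \<in> {x..<x + int K}" for p z
  proof -
    from u[OF z] v have "u z > 0" by (cases "u z") auto
    then have "\<bar>walk \<omega> p z (u z) - walk \<omega> p z (u x)\<bar> \<le> H * sqrt \<bar>real (u z) - real (u x)\<bar>"
      by (intro walk_diff site_in_range u_le_T)
    also have "\<bar>real (u z) - real (u x)\<bar> \<le> real (nat (z - x)) * L"
      using u_lipschitz[of x "nat (z - x)"] z by simp
    also have "\<dots> \<le> real K * L"
      using z L_nonneg by (intro mult_right_mono) auto
    also have "H * sqrt (real K * L) = sqrt (H\<^sup>2 * (real K * L))"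
      using H_ge_1 by (simp add: real_sqrt_mult)
    also have "\<dots> \<le> sqrt (v\<^sub>0 / 32)"
      using v(2) by simp
    finally show ?thesis using H_ge_1 by simp
  qed
  have mem: "y - 1 \<in> {x..<x + int K}" "y + 1 \<in> {x..<x + int K}" "y \<in> {x..<x + int K}"
    using i K by (auto simp: y_def)
  \<comment> \<open>In units of \<open>sqrt (v\<^sub>0 / 32)\<close> the contrast is at least 8 and
    the four replacements cost at most 4. So twice the mass is at least 4 units, and 2 units are
    \<open>sqrt (v\<^sub>0 / 8)\<close>.\<close>
  have "sqrt (2 * real (u x)) \<ge> sqrt (2 * v\<^sub>0)" using x by simp
  moreover have "sqrt (2 * v\<^sub>0) = 4 * sqrt (v\<^sub>0 / 8)" "sqrt (v\<^sub>0 / 8) = 2 * sqrt (v\<^sub>0 / 32)"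
    using real_sqrt_mult[of 16 "v\<^sub>0 / 8"] real_sqrt_mult[of 4 "v\<^sub>0 / 32"] by simp_all
  ultimately have "mass final y \<ge> sqrt (v\<^sub>0 / 8)"
    using i(2) mass_ge_contrast[of y] close[OF mem(1), of Oil] close[OF mem(1), of Water]
      close[OF mem(2), of Oil] close[OF mem(2), of Water]
    unfolding contrast_def y_def[symmetric] by linarith
  with mem(3) show ?thesis by blast
qed

lemma interval_mass:
  assumes v: "v\<^sub>0 > 0" "v\<^sub>0 \<ge> 32 * H\<^sup>2 * real K * L"
    and u: "\<And>y. y \<in> {x..<x + int (m * K)} \<Longrightarrow> real (u y) \<ge> v\<^sub>0"
    and b: "b > 0"
  shows "real m * sqrt (v\<^sub>0 / 8) \<le> 2 * real n"
proof -
  have "real m * sqrt (v\<^sub>0 / 8) \<le> (\<Sum>y\<in>{x..<x + int (m * K)}. mass final y)"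
    using u
  proof (induction m)
    case (Suc m)
    let ?z = "x + int (m * K)"
    obtain y where y: "y \<in> {?z..<?z + int K}" "mass final y \<ge> sqrt (v\<^sub>0 / 8)"
    proof -
      have "v\<^sub>0 \<le> real (u y)" if "y \<in> {?z..<?z + int K}" for y
        proof (rule Suc.prems)
        have "x \<le> x + int (m * K)" by (simp del: of_nat_mult)
        then have "x \<le> y" using that by (simp del: of_nat_mult)
        then show "y \<in> {x..<x + int (Suc m * K)}" using that by (simp add: algebra_simps)
      qed
      from block_mass[OF v this b] that show ?thesis by blast
    qed
    have "{x..<x + int (Suc m * K)} = {x..<?z} \<union> {?z..<?z + int K}"
      by (subst ivl_disj_un) (auto simp: algebra_simps simp flip: of_nat_mult)
    then have "(\<Sum>y\<in>{x..<x + int (Suc m * K)}. mass final y)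
        = (\<Sum>y\<in>{x..<?z}. mass final y) + (\<Sum>y\<in>{?z..<?z + int K}. mass final y)"
      by (simp add: sum.union_disjoint ivl_disj_int)
    moreover have "mass final y \<le> (\<Sum>y\<in>{?z..<?z + int K}. mass final y)"
      using y by (intro member_le_sum) (auto simp: mass_nonneg)
    moreover have "real m * sqrt (v\<^sub>0 / 8) \<le> (\<Sum>y\<in>{x..<?z}. mass final y)"
      using Suc by auto
    ultimately show ?case using y by (simp add: algebra_simps)
  qed simp
  also have "\<dots> \<le> 2 * real n"
    unfolding final_def by (rule sum_mass_le[OF proper]) simp
  finally show ?thesis .
qed

end

section \<open>Bounds on firing counts and tails at the scale g = n^(1/4)\<close>

context
  fixes g :: real
  assumes n: "real n = g ^ 4"
    and g: "g \<ge> 1024 * H\<^sup>2"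
    and b: "b > 0" "real b \<le> H"
begin

lemma g_ge: "g \<ge> 1024 * H" "g \<ge> 1024"
proof -
  have "H * 1 \<le> H * H" using H_ge_1 by (intro mult_left_mono) auto
  then show "g \<ge> 1024 * H" using g unfolding power2_eq_square by linarith
  then show "g \<ge> 1024" using H_ge_1 by linarith
qed

text \<open>If the maximum \<open>S\<^sup>2\<close> of \<open>u\<close> exceeded n^(3/2), the
  Lipschitz bound would keep \<open>u\<close> above half of it on some 9g blocks next to the
  maximiser, and \<open>interval_mass\<close> would yield more than 2n particles.\<close>

lemma sqrt_u_le: "sqrt (real (u x)) \<le> g ^ 3"
proof -
  obtain x\<^sub>0 where x0: "\<And>x. u x \<le> u x\<^sub>0"
    using ex_has_greatest_nat[of "\<lambda>_. True" 0 u "Suc T"] u_le_T by (auto simp: less_Suc_eq_le)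
  define S where "S = sqrt (real (u x\<^sub>0))"
  have max: "sqrt (real (u x)) \<le> S" for x
    using x0 by (simp add: S_def)
  have "S \<le> g ^ 3"
  proof (rule ccontr)
    assume "\<not> S \<le> g ^ 3"
    then have S: "S > g ^ 3" by simp
    have gS: "0 < g" "0 < S" using g_ge S by (auto intro: le_less_trans[rotated])
    \<comment> \<open>Each block will carry \<open>S / 4\<close>, which exceeds
      \<open>g ^ 3 / 4\<close>, so \<open>9 * g\<close> blocks carry more than 9n/4
      particles.\<close>
    define m where "m = nat \<lceil>9 * g\<rceil>"
    have m: "real m \<ge> 9 * g" "real m \<le> 10 * g"
      unfolding m_def using g_ge by linarith+
    have L: "2 * real n + 2 * H * S \<le> 4 * g * S"
    proof -
      have "g * g ^ 3 \<le> g * S" "H * S \<le> g * S"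
        using S gS g_ge H_ge_1 by (intro mult_left_mono mult_right_mono; simp)+
      then show ?thesis by (simp add: n numeral_eq_Suc algebra_simps)
    qed
    have S2: "S * S = real (u x\<^sub>0)" by (simp add: S_def)
    have "1024 * H\<^sup>2 * H * g * S \<le> S * S"
    proof -
      have "1024 * H\<^sup>2 * H * g * S \<le> g * g * g * S"
        using g g_ge gS H_ge_1 by (intro mult_right_mono mult_mono) auto
      also have "\<dots> \<le> S * S"
        using S gS by (intro mult_right_mono) (auto simp: power3_eq_cube)
      finally show ?thesis .
    qed
    then have thr: "S * S / 2 \<ge> 32 * H\<^sup>2 * real (4 * b) * (4 * g * S)"
    proof -
      have "H\<^sup>2 * real b * (g * S) \<le> H\<^sup>2 * H * (g * S)"
        using b gS by (intro mult_right_mono mult_left_mono) auto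
      then show ?thesis using \<open>1024 * H\<^sup>2 * H * g * S \<le> S * S\<close> by (simp add: algebra_simps)
    qed
    have len: "real (m * (4 * b)) * (4 * g * S) \<le> S * S / 2"
    proof -
      have "real m * real b * (g * S) \<le> (10 * g) * H * (g * S)"
        using m b gS by (intro mult_right_mono mult_mono) auto
      also have "\<dots> = 10 * H * (g * g * S)" by simp
      also have "\<dots> \<le> g / 100 * (g * g * S)"
        using g_ge gS by (intro mult_right_mono) auto
      also have "\<dots> = (g ^ 3) * S / 100" by (simp add: power3_eq_cube)
      also have "\<dots> \<le> S * S / 100"
        using S gS by (intro divide_right_mono mult_right_mono) auto
      finally have "real m * real b * (g * S) \<le> S * S / 100" .
      then show ?thesis using gS by (simp add: algebra_simps)
    qed
    have "real m * sqrt (S * S / 2 / 8) \<le> 2 * real n"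
    proof (rule interval_mass[OF max L refl _ thr _ b(1)])
      fix y assume y: "y \<in> {x\<^sub>0..<x\<^sub>0 + int (m * (4 * b))}"
      have "\<bar>real (u (x\<^sub>0 + int (nat (y - x\<^sub>0)))) - real (u x\<^sub>0)\<bar> \<le> real (nat (y - x\<^sub>0)) * (4 * g * S)"
        by (rule u_lipschitz[OF max L refl])
      also have "\<dots> \<le> real (m * (4 * b)) * (4 * g * S)"
        using y gS by (intro mult_right_mono) (auto simp: nat_le_iff simp del: of_nat_mult)
      finally show "S * S / 2 \<le> real (u y)"
        using len S2 y by simp
    qed (use gS in auto)
    then have "real m * (S / 4) \<le> 2 * real n"
      using gS real_sqrt_divide[of "S * S" 16] by simp
    moreover have "(9 * g) * (S / 4) \<le> real m * (S / 4)"
      using m gS by (intro mult_right_mono) auto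
    moreover have "g * g ^ 3 < g * S" using S gS by (intro mult_strict_left_mono)
    moreover have "g * g ^ 3 = real n" by (simp add: n numeral_eq_Suc)
    ultimately show False by (simp add: algebra_simps)
  qed
  with max show ?thesis by (meson order_trans)
qed

text \<open>\<open>f\<close> treats both sides of the origin at once. Adding up the drops from
  \<open>R\<close> inwards makes \<open>u\<close> at least \<open>R * M / 8\<close> on the half
  nearer the origin, where each of \<open>m\<close> blocks then carries
  \<open>sqrt (R * M) / 8\<close>.\<close>

lemma no_large_tail:
  fixes f :: "nat \<Rightarrow> int" and M :: real
  assumes f: "f = int \<or> f = (\<lambda>k. - int k)"
    and drop: "\<And>k. k < R \<Longrightarrow> real (u (f k)) - real (u (f (Suc k))) \<ge> M / 4"
    and M: "M > 0" "m * (4 * b) \<le> R div 2" "R > 0"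
    and big: "real R * M \<ge> 4096 * H ^ 3 * real n"
  shows "real m * sqrt (real R * M) \<le> 16 * real n"
proof -
  have lower: "real (u (f (R - k))) \<ge> real k * (M / 4)" if "k \<le> R" for k
    using that
  proof (induction k)
    case (Suc k)
    then have "Suc (R - Suc k) = R - k" by simp
    then show ?case using Suc drop[of "R - Suc k"] by (simp add: algebra_simps)
  qed simp
  have half: "real (u (f k)) \<ge> real R * M / 8" if "k < m * (4 * b)" for k
  proof -
    have "k \<le> R div 2" using that M by simp
    then have k: "k \<le> R" "2 * (R - k) \<ge> R" by auto
    then have "real R * (M / 8) \<le> real (2 * (R - k)) * (M / 8)"
      using M by (intro mult_right_mono) auto
    also have "\<dots> = real (R - k) * (M / 4)" by simp
    also have "\<dots> \<le> real (u (f k))" using lower[of "R - k"] k by simp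
    finally show ?thesis by simp
  qed
  have gpos: "g > 0" using g_ge by simp
  \<comment> \<open>\<open>sqrt_u_le\<close> allows \<open>S = g ^ 3\<close>, which makes 4n a
    Lipschitz constant.\<close>
  have L: "2 * real n + 2 * H * g ^ 3 \<le> 4 * real n"
  proof -
    have "H * g ^ 3 \<le> g * g ^ 3" using g_ge gpos H_ge_1 by (intro mult_right_mono) auto
    then show ?thesis by (simp add: n numeral_eq_Suc)
  qed
  have thr: "real R * M / 8 \<ge> 32 * H\<^sup>2 * real (4 * b) * (4 * real n)"
  proof -
    have "H\<^sup>2 * real b * real n \<le> H\<^sup>2 * H * real n"
      using b by (intro mult_right_mono mult_left_mono) auto
    then show ?thesis using big by (simp add: power3_eq_cube power2_eq_square algebra_simps)
  qed
  \<comment> \<open>On the left side the sites 0, -1, ..., \<open>1 - m * (4 * b)\<close> form an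
    interval that starts at its far end.\<close>
  define x where "x = (if f = int then 0 else 1 - int (m * (4 * b)))"
  have "real m * sqrt (real R * M / 8 / 8) \<le> 2 * real n"
  proof (rule interval_mass[OF sqrt_u_le L refl _ thr _ b(1), of x])
    fix y assume y: "y \<in> {x..<x + int (m * (4 * b))}"
    then have "y = f (nat \<bar>y\<bar>)" "nat \<bar>y\<bar> < m * (4 * b)"
      using f by (auto simp: x_def nat_less_iff split: if_splits)
    then show "real (u y) \<ge> real R * M / 8" using half by metis
  qed (use M in auto)
  moreover have "sqrt (real R * M / 8 / 8) = sqrt (real R * M) / 8"
    using real_sqrt_divide[of "real R * M" 64] by simp
  ultimately show ?thesis by (simp only: times_divide_eq_right)
qed

text \<open>If more than \<open>M\<close> particles lay outside, one side would hold at least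
  \<open>M / 2\<close>, which bounds the outward flux across each edge up to \<open>R\<close> from
  below. Two noise terms of at most \<open>M / 8\<close> leave a drop of \<open>M / 4\<close> per
  site, against \<open>no_large_tail\<close>.\<close>

lemma num_outside_le:
  assumes stopped: "active final = {}"
    and M: "M > 0" "8 * H * g ^ 3 \<le> M"
    and R: "R = nat \<lfloor>r\<rfloor>" "R > 0" "m * (4 * b) \<le> R div 2"
    and big: "real R * M \<ge> 4096 * H ^ 3 * real n" "real m * sqrt (real R * M) > 16 * real n"
  shows "num_outside n r \<omega> \<le> M"
proof (rule ccontr)
  assume "\<not> num_outside n r \<omega> \<le> M"
  define L where "L = max (int T) (int R) + 1"
  have LT: "L > int T" "int R \<le> L" by (auto simp: L_def)
  have noise_le: "\<bar>noise \<omega> final x\<bar> \<le> M / 8" for x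
    using abs_noise_le[of x] mult_left_mono[OF sqrt_u_le[of x], of H] H_ge_1 M(2) by linarith
  let ?right = "\<lambda>k. \<Sum>y\<in>{int k<..L}. mass final y"
  let ?left = "\<lambda>k. \<Sum>y\<in>{-L..- int k - 1}. mass final y"
  have "num_outside n r \<omega> = (\<Sum>x | real_of_int \<bar>x\<bar> > r \<and> final_num n \<omega> Oil x + final_num n \<omega> Water x \<noteq> 0.
             mass final x)"
    unfolding num_outside_eq_sum
    using stopped by (simp add: final_def final_num_eq mass_def)
  also have "\<dots> \<le> (\<Sum>x\<in>{int R<..L} \<union> {-L..- int R - 1}. mass final x)"
  proof (rule sum_mono2)
    show "{x. real_of_int \<bar>x\<bar> > r \<and> final_num n \<omega> Oil x + final_num n \<omega> Water x \<noteq> 0}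
      \<subseteq> {int R<..L} \<union> {-L..- int R - 1}"
    proof
      fix x assume "x \<in> {x. real_of_int \<bar>x\<bar> > r \<and> final_num n \<omega> Oil x + final_num n \<omega> Water x \<noteq> 0}"
      then have x: "real_of_int \<bar>x\<bar> > r" "final_num n \<omega> Oil x + final_num n \<omega> Water x \<noteq> 0"
        by auto
      have "\<bar>x\<bar> \<le> L"
      proof (rule ccontr)
        assume "\<not> \<bar>x\<bar> \<le> L"
        then have "num final p x = 0" for p
          unfolding final_def using LT by (intro support_state_at(1)[OF proper]) simp
        then show False using x(2) stopped by (simp add: final_num_eq final_def)
      qed
      moreover have "\<bar>x\<bar> > int R"
        using x(1) R by (simp add: floor_less_iff)
      ultimately show "x \<in> {int R<..L} \<union> {-L..- int R - 1}" by auto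
    qed
  qed (auto simp: mass_nonneg)
  also have "\<dots> = ?right R + ?left R"
    by (rule sum.union_disjoint) auto
  finally have "?right R + ?left R > M"
    using \<open>\<not> num_outside n r \<omega> \<le> M\<close> by simp
  then consider "?right R \<ge> M / 2" | "?left R \<ge> M / 2" by linarith
  then show False
  proof cases
    case 1
    have "real m * sqrt (real R * M) \<le> 16 * real n"
    proof (rule no_large_tail[of int])
      fix k assume k: "k < R"
      have "?right R \<le> ?right k"
        using k by (intro sum_mono2) (auto simp: mass_nonneg)
      also have "\<dots> = flux \<omega> final (int k)"
        using sum_mass_right[OF proper _ LT(1), of "int k" n] k LT(2) by (simp add: final_def)
      finally have "flux \<omega> final (int k) \<ge> M / 2" using 1 by simp
      then show "real (u (int k)) - real (u (int (Suc k))) \<ge> M / 4"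
        using noise_le[of "int k"] noise_le[of "int k + 1"] unfolding flux_def
        by (simp add: add.commute)
    qed (use M R big in auto)
    then show False using big by simp
  next
    case 2
    have "real m * sqrt (real R * M) \<le> 16 * real n"
    proof (rule no_large_tail[of "\<lambda>k. - int k"])
      fix k assume k: "k < R"
      \<comment> \<open>Edges are indexed by their left ends, so the edge between
        \<open>- int k\<close> and its left neighbour has index \<open>- int k - 1\<close>.\<close>
      have "?left R \<le> ?left k"
        using k by (intro sum_mono2) (auto simp: mass_nonneg)
      also have "\<dots> = - flux \<omega> final (- int k - 1)"
        using sum_mass_left[OF proper _ _ LT(1), of "- int k - 1" n] k LT(2) by (simp add: final_def)
      finally have flux: "- flux \<omega> final (- int k - 1) \<ge> M / 2" using 2 by simp
      have "- int k - 1 + 1 = - int k" "- int (Suc k) = - int k - 1" by simp_all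
      with flux show "real (u (- int k)) - real (u (- int (Suc k))) \<ge> M / 4"
        using noise_le[of "- int k"] noise_le[of "- int k - 1"] unfolding flux_def
        by (simp only: abs_le_iff) linarith
    qed (use M R big in auto)
    then show False using big by simp
  qed
qed

end

end

section \<open>Sums of random signs\<close>

locale rademacher = prob_space +
  fixes X :: "'i \<Rightarrow> 'a \<Rightarrow> real" and I :: "'i set"
  assumes indep: "indep_vars (\<lambda>_. borel) X I"
    and sign: "\<And>i \<omega>. i \<in> I \<Longrightarrow> X i \<omega> \<in> {1, -1}"
    and centred: "\<And>i. i \<in> I \<Longrightarrow> expectation (X i) = 0"
    and finite: "finite I"
begin

lemma random_variable_X [measurable]: "i \<in> I \<Longrightarrow> random_variable borel (X i)"
  using indep by (auto simp: indep_vars_def)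

lemma X_powers:
  assumes "i \<in> I"
  shows "X i \<omega> * X i \<omega> = 1" "X i \<omega> * (X i \<omega> * z) = z" "\<bar>X i \<omega>\<bar> = 1"
  using sign[OF assms, of \<omega>] by auto

text \<open>Each sign ranges over an interval of length 2, so Hoeffding's exponent is -2 (h^2 card
  I) / (4 card I).\<close>

lemma hoeffding:
  assumes "I \<noteq> {}" "h \<ge> 0"
  shows "prob {\<omega> \<in> space M. \<bar>\<Sum>i\<in>I. X i \<omega>\<bar> \<ge> h * sqrt (real (card I))} \<le> 2 * exp (- (h\<^sup>2 / 2))"
proof -
  have card: "card I > 0" using assms finite by (simp add: card_gt_0_iff)
  interpret Hoeffding_ineq M I X "\<lambda>_. -1" "\<lambda>_. 1" "\<Sum>i\<in>I. expectation (X i)"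
  proof unfold_locales
    show "AE \<omega> in M. X i \<omega> \<in> {-1..1}" if "i \<in> I" for i
      using sign[OF that] by (intro AE_I2) (metis atLeastAtMost_iff insertE neg_le_iff_le order_refl
          singletonD zero_le_one le_minus_one_simps(1) order_trans)
  qed (simp_all add: indep finite)
  show ?thesis
    using Hoeffding_ineq_abs_ge[of "h * sqrt (real (card I))"] assms card
    by (simp add: centred power_mult_distrib field_simps)
qed

lemma abs_sum_le:
  assumes "A \<subseteq> I"
  shows "\<bar>\<Sum>i\<in>A. X i \<omega>\<bar> \<le> real (card A)"
proof -
  have "\<bar>\<Sum>i\<in>A. X i \<omega>\<bar> \<le> (\<Sum>i\<in>A. \<bar>X i \<omega>\<bar>)" by (rule sum_abs)
  also have "\<dots> = (\<Sum>i\<in>A. 1)" using assms by (intro sum.cong) (auto simp: X_powers)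
  finally show ?thesis by simp
qed

lemma integrable_sum_power [simp]:
  assumes "A \<subseteq> I"
  shows "integrable M (\<lambda>\<omega>. (\<Sum>i\<in>A. X i \<omega>) ^ k)"
proof (rule integrable_const_bound[of _ "real (card A) ^ k"])
  show "AE \<omega> in M. norm ((\<Sum>i\<in>A. X i \<omega>) ^ k) \<le> real (card A) ^ k"
    using abs_sum_le[OF assms] by (simp add: power_abs power_mono)
  have [measurable]: "\<And>i. i \<in> A \<Longrightarrow> random_variable borel (X i)" using assms by auto
  show "(\<lambda>\<omega>. (\<Sum>i\<in>A. X i \<omega>) ^ k) \<in> borel_measurable M" by measurable
qed

lemma mixed_moment:
  assumes "insert i A \<subseteq> I" "i \<notin> A"
  shows "expectation (\<lambda>\<omega>. X i \<omega> * (\<Sum>i\<in>A. X i \<omega>) ^ k) = 0"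
    and "integrable M (\<lambda>\<omega>. X i \<omega> * (\<Sum>i\<in>A. X i \<omega>) ^ k)"
proof -
  have "finite A" using finite assms by (meson finite_subset insert_subset)
  then have "indep_var borel (X i) borel (\<lambda>\<omega>. \<Sum>i\<in>A. X i \<omega>)"
    using assms by (intro indep_vars_sum indep_vars_subset[OF indep])
  from indep_var_compose[OF this, of "\<lambda>x. x" borel "\<lambda>x. x ^ k" borel]
  have ind: "indep_var borel (X i) borel (\<lambda>\<omega>. (\<Sum>i\<in>A. X i \<omega>) ^ k)"
    by (simp add: comp_def)
  have int: "integrable M (X i)"
    using integrable_sum_power[of "{i}" 1] assms by simp
  show "integrable M (\<lambda>\<omega>. X i \<omega> * (\<Sum>i\<in>A. X i \<omega>) ^ k)"
    using assms by (intro indep_var_integrable[OF ind int]) simp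
  show "expectation (\<lambda>\<omega>. X i \<omega> * (\<Sum>i\<in>A. X i \<omega>) ^ k) = 0"
    using assms by (subst indep_var_lebesgue_integral[OF ind int]) (simp_all add: centred)
qed

text \<open>Add one sign to a sum Z. Its square is 1 and the terms with an odd power of it vanish by
  \<open>mixed_moment\<close>, so the second moment grows by 1 and the fourth by 6 E(Z^2) +
  1.\<close>

lemma moments:
  assumes "A \<subseteq> I"
  shows "expectation (\<lambda>\<omega>. (\<Sum>i\<in>A. X i \<omega>) ^ 2) = real (card A)"
    and "expectation (\<lambda>\<omega>. (\<Sum>i\<in>A. X i \<omega>) ^ 4) = 3 * (real (card A))\<^sup>2 - 2 * real (card A)"
proof -
  have "finite A" using assms finite by (rule finite_subset)
  then have "expectation (\<lambda>\<omega>. (\<Sum>i\<in>A. X i \<omega>) ^ 2) = real (card A) \<and>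
    expectation (\<lambda>\<omega>. (\<Sum>i\<in>A. X i \<omega>) ^ 4) = 3 * (real (card A))\<^sup>2 - 2 * real (card A)"
    using assms
  proof (induction A rule: finite_induct)
    case (insert i A)
    let ?Z = "\<lambda>\<omega>. \<Sum>i\<in>A. X i \<omega>"
    have i: "i \<in> I" and A: "A \<subseteq> I" using insert.prems by auto
    note mixed = mixed_moment[OF insert.prems insert.hyps(2)]
    have sq: "(\<lambda>\<omega>. (\<Sum>i\<in>insert i A. X i \<omega>) ^ 2) = (\<lambda>\<omega>. ?Z \<omega> ^ 2 + 2 * (X i \<omega> * ?Z \<omega> ^ 1) + 1)"
    proof
      fix \<omega>
      show "(\<Sum>i\<in>insert i A. X i \<omega>) ^ 2 = ?Z \<omega> ^ 2 + 2 * (X i \<omega> * ?Z \<omega> ^ 1) + 1"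
        using insert.hyps i by (simp add: power2_eq_square algebra_simps X_powers)
    qed
    have fourth: "(\<lambda>\<omega>. (\<Sum>i\<in>insert i A. X i \<omega>) ^ 4) = (\<lambda>\<omega>. ?Z \<omega> ^ 4 + 4 * (X i \<omega> * ?Z \<omega> ^ 3)
        + 6 * ?Z \<omega> ^ 2 + 4 * (X i \<omega> * ?Z \<omega> ^ 1) + 1)"
    proof
      fix \<omega>
      show "(\<Sum>i\<in>insert i A. X i \<omega>) ^ 4 = ?Z \<omega> ^ 4 + 4 * (X i \<omega> * ?Z \<omega> ^ 3)
        + 6 * ?Z \<omega> ^ 2 + 4 * (X i \<omega> * ?Z \<omega> ^ 1) + 1"
        using insert.hyps sign[OF i, of \<omega>]
        by (auto simp: power4_eq_xxxx power3_eq_cube power2_eq_square algebra_simps)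
    qed
    have "expectation (\<lambda>\<omega>. (\<Sum>i\<in>insert i A. X i \<omega>) ^ 2) = real (card A) + 1"
      unfolding sq using insert.IH[OF A] mixed[of 1] integrable_sum_power[OF A, of 2]
      by (simp add: prob_space del: power_one_right)
    moreover have "expectation (\<lambda>\<omega>. (\<Sum>i\<in>insert i A. X i \<omega>) ^ 4)
        = 3 * (real (card A))\<^sup>2 - 2 * real (card A) + 6 * real (card A) + 1"
      unfolding fourth using insert.IH[OF A] mixed[of 1] mixed[of 3]
        integrable_sum_power[OF A, of 2] integrable_sum_power[OF A, of 4]
      by (simp add: prob_space del: power_one_right)
    ultimately show ?case
      using insert.hyps by (simp add: power2_eq_square algebra_simps)
  qed simp
  then show "expectation (\<lambda>\<omega>. (\<Sum>i\<in>A. X i \<omega>) ^ 2) = real (card A)"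
    and "expectation (\<lambda>\<omega>. (\<Sum>i\<in>A. X i \<omega>) ^ 4) = 3 * (real (card A))\<^sup>2 - 2 * real (card A)"
    by auto
qed

text \<open>A bound of Paley-Zygmund type: as the fourth moment is at most three times the squared
  second moment, the square of the sum cannot lie below half its mean too often.\<close>

lemma anti_concentration:
  assumes "I \<noteq> {}"
  shows "prob {\<omega> \<in> space M. \<bar>\<Sum>i\<in>I. X i \<omega>\<bar> < sqrt (real (card I) / 2)} \<le> 9 / 10"
proof -
  let ?Z = "\<lambda>\<omega>. \<Sum>i\<in>I. X i \<omega>"
  define m where "m = real (card I)"
  have m: "m \<ge> 1" using assms finite by (simp add: m_def Suc_le_eq card_gt_0_iff)
  let ?S = "{\<omega> \<in> space M. \<bar>?Z \<omega>\<bar> < sqrt (m / 2)}"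
  have S: "?S \<in> events" by measurable
  \<comment> \<open>The quadratic with double root \<open>z = 4\<close> and equal to 1 at \<open>z = 1/2\<close>,
    evaluated at \<open>z = Z\<^sup>2 / m\<close>, dominates the indicator.\<close>
  let ?q = "\<lambda>\<omega>. 4 / 49 * (?Z \<omega> ^ 4 / m\<^sup>2 - 8 * (?Z \<omega> ^ 2 / m) + 16)"
  have "prob ?S = expectation (indicator ?S)"
    using S by simp
  also have "\<dots> \<le> expectation ?q"
  proof (rule integral_mono)
    show "integrable M (indicator ?S :: 'a \<Rightarrow> real)"
      using S by (simp add: integrable_indicator_iff emeasure_eq_measure)
    show "integrable M ?q"
      using integrable_sum_power[of I 2] integrable_sum_power[of I 4] by simp
    fix \<omega> assume "\<omega> \<in> space M"
    define z where "z = ?Z \<omega> ^ 2 / m"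
    have q: "?q \<omega> = 4 / 49 * (z - 4)\<^sup>2"
      using m by (simp add: z_def power2_eq_square power4_eq_xxxx field_simps)
    show "indicator ?S \<omega> \<le> ?q \<omega>"
    proof (cases "\<omega> \<in> ?S")
      case True
      then have "\<bar>?Z \<omega>\<bar> ^ 2 < sqrt (m / 2) ^ 2" by (intro power_strict_mono) auto
      then have "?Z \<omega> ^ 2 < m / 2" using m by simp
      then have "7 / 2 \<le> 4 - z" using m by (simp add: z_def field_simps)
      then have "(7 / 2)\<^sup>2 \<le> (4 - z)\<^sup>2" by (rule power_mono) simp
      then have "(7 / 2)\<^sup>2 \<le> (z - 4)\<^sup>2" by (simp only: power2_commute)
      then show ?thesis using True unfolding q by (simp add: power2_eq_square)
    next
      case False
      then show ?thesis unfolding q by simp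
    qed
  qed
  also have "\<dots> = 4 / 49 * ((3 * m\<^sup>2 - 2 * m) / m\<^sup>2 - 8 * (m / m) + 16)"
    using moments[of I] integrable_sum_power[of I 2] integrable_sum_power[of I 4]
    by (simp add: prob_space m_def)
  \<comment> \<open>Up to a negative term the bracket is 3 - 8 + 16, and 44/49 is just below
    9/10.\<close>
  also have "\<dots> \<le> 4 / 49 * 11"
    using m by (simp add: field_simps power2_eq_square)
  finally show ?thesis by (simp add: m_def)
qed

end

section \<open>The instructions\<close>

interpretation inst: prob_space instruction_space
  by (rule prob_space_instruction_space)

lemma instruction_event_eq_vimage:
  "{\<omega> \<in> space instruction_space. \<omega> i \<in> A} = (\<lambda>\<omega>. \<omega> i) -` A \<inter> space instruction_space"
  by auto

lemma measurable_instruction [measurable]: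
  "i \<in> instruction_indices \<Longrightarrow> (\<lambda>\<omega>. \<omega> i) \<in> measurable instruction_space (count_space UNIV)"
  using indep_vars_instructions unfolding inst.indep_vars_def
  by (auto cong: measurable_cong_sets)

lemma event_instruction:
  assumes "i \<in> instruction_indices"
  shows "{\<omega> \<in> space instruction_space. \<omega> i \<in> A} \<in> inst.events"
  using measurable_instruction[OF assms] by measurable

lemma integral_instruction:
  assumes "i \<in> instruction_indices"
  shows "(\<integral>\<omega>. f (\<omega> i) \<partial>instruction_space) = (f 1 + f (-1) :: real) / 2"
proof -
  have "(\<integral>\<omega>. f (\<omega> i) \<partial>instruction_space)
      = integral\<^sup>L (distr instruction_space (measure_pmf (pmf_of_set {1, -1})) (\<lambda>\<omega>. \<omega> i)) f"
    using measurable_instruction[OF assms]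
    by (subst integral_distr) (auto cong: measurable_cong_sets)
  also have "\<dots> = (f 1 + f (-1)) / 2"
    unfolding distr_instruction[OF assms] by (subst integral_pmf_of_set) auto
  finally show ?thesis .
qed

lemma prob_instruction:
  assumes "i \<in> instruction_indices"
  shows "inst.prob {\<omega> \<in> space instruction_space. \<omega> i \<in> A}
    = (indicator A (1::int) + indicator A (-1)) / 2"
proof -
  have "inst.prob {\<omega> \<in> space instruction_space. \<omega> i \<in> A}
      = (\<integral>\<omega>. indicator {\<omega> \<in> space instruction_space. \<omega> i \<in> A} \<omega> \<partial>instruction_space)"
    using event_instruction[OF assms] by simp
  also have "\<dots> = (\<integral>\<omega>. indicator A (\<omega> i) \<partial>instruction_space)"
    by (intro Bochner_Integration.integral_cong) (auto simp: indicator_def)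
  finally show ?thesis by (simp add: integral_instruction[OF assms])
qed

lemma prob_cylinder:
  assumes "finite F" "F \<subseteq> instruction_indices" "\<And>i. i \<in> F \<Longrightarrow> c i \<in> {1, -1}"
  shows "{\<omega> \<in> space instruction_space. \<forall>i\<in>F. \<omega> i = c i} \<in> inst.events"
    and "inst.prob {\<omega> \<in> space instruction_space. \<forall>i\<in>F. \<omega> i = c i} = (1 / 2) ^ card F"
proof -
  let ?E = "{\<omega> \<in> space instruction_space. \<forall>i\<in>F. \<omega> i = c i}"
  have [measurable]: "i \<in> F \<Longrightarrow> (\<lambda>\<omega>. \<omega> i) \<in> measurable instruction_space (count_space UNIV)" for i
    using assms(2) by (auto intro: measurable_instruction)
  show "?E \<in> inst.events" using assms(1) by measurable
  show "inst.prob ?E = (1 / 2) ^ card F"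
  proof (cases "F = {}")
    case True
    then show ?thesis by (simp add: inst.prob_space)
  next
    case False
    have "inst.prob ?E = inst.prob (\<Inter>i\<in>F. (\<lambda>\<omega>. \<omega> i) -` {c i} \<inter> space instruction_space)"
      using False by (intro arg_cong[where f = inst.prob]) auto
    also have "\<dots> = (\<Prod>i\<in>F. inst.prob ((\<lambda>\<omega>. \<omega> i) -` {c i} \<inter> space instruction_space))"
      using assms False by (intro inst.indep_varsD[OF indep_vars_instructions]) auto
    also have "\<dots> = (\<Prod>i\<in>F. 1 / 2)"
    proof (rule prod.cong)
      fix i assume "i \<in> F"
      then show "inst.prob ((\<lambda>\<omega>. \<omega> i) -` {c i} \<inter> space instruction_space) = 1 / 2"
        using prob_instruction[of i "{c i}"] assms(2) assms(3)[of i]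
        unfolding instruction_event_eq_vimage by (auto simp: indicator_def)
    qed simp
    finally show ?thesis by simp
  qed
qed

lemma indep_coins: "inst.indep_vars (\<lambda>_. borel) coin instruction_indices"
proof -
  have "inst.indep_vars (\<lambda>_. borel) (\<lambda>i \<omega>. (if \<omega> i = 1 then 1 else -1 :: real)) instruction_indices"
    by (rule inst.indep_vars_compose2[OF indep_vars_instructions]) simp
  then show ?thesis by (simp add: coin_def[abs_def])
qed

lemma rademacher_signed_coins:
  assumes "finite A" "A \<subseteq> instruction_indices" "\<And>i. i \<in> A \<Longrightarrow> \<sigma> i \<in> {1, -1}"
  shows "rademacher instruction_space (\<lambda>i \<omega>. \<sigma> i * coin i \<omega>) A"
proof unfold_locales
  show "inst.indep_vars (\<lambda>_. borel) (\<lambda>i \<omega>. \<sigma> i * coin i \<omega>) A"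
    by (rule inst.indep_vars_compose2[OF inst.indep_vars_subset[OF indep_coins assms(2)]]) simp
  fix i assume i: "i \<in> A"
  show "\<sigma> i * coin i \<omega> \<in> {1, -1}" for \<omega>
    using assms(3)[OF i] by (auto simp: coin_def)
  have "(\<integral>\<omega>. coin i \<omega> \<partial>instruction_space) = 0"
    using integral_instruction[of i "\<lambda>z. if z = 1 then 1 else -1"] i assms(2)
    by (auto simp: coin_def)
  then show "inst.expectation (\<lambda>\<omega>. \<sigma> i * coin i \<omega>) = 0" by simp
qed (rule assms(1))

lemma measurable_coin [measurable]:
  "i \<in> instruction_indices \<Longrightarrow> coin i \<in> borel_measurable instruction_space"
  using indep_coins by (auto simp: inst.indep_vars_def)

lemma measurable_walk [measurable]: "(\<lambda>\<omega>. walk \<omega> p x k) \<in> borel_measurable instruction_space"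
  unfolding walk_def
  by (rule borel_measurable_sum, rule measurable_coin) (auto simp: instruction_indices_def)

lemma measurable_contrast [measurable]: "(\<lambda>\<omega>. contrast \<omega> y v) \<in> borel_measurable instruction_space"
  unfolding contrast_def by measurable

lemma prob_oscillation:
  assumes "j < k" "H \<ge> 0"
  shows "inst.prob {\<omega> \<in> space instruction_space.
      \<bar>walk \<omega> p x k - walk \<omega> p x j\<bar> > H * sqrt (real k - real j)} \<le> 2 * exp (- (H\<^sup>2 / 2))"
proof -
  let ?A = "(\<lambda>i. (p, x, i)) ` {j<..k}"
  interpret rademacher instruction_space "\<lambda>i \<omega>. 1 * coin i \<omega>" ?A
    by (rule rademacher_signed_coins) (auto simp: instruction_indices_def)
  have inj: "inj_on (\<lambda>i. (p, x, i)) {j<..k}" by (auto intro: inj_onI)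
  have "walk \<omega> p x k - walk \<omega> p x j = (\<Sum>i\<in>?A. coin i \<omega>)" for \<omega>
  proof -
    have "{1..k} = {1..j} \<union> {j<..k}" using assms by auto
    then have "walk \<omega> p x k = walk \<omega> p x j + (\<Sum>i\<in>{j<..k}. coin (p, x, i) \<omega>)"
      unfolding walk_def by (simp add: sum.union_disjoint ivl_disj_int)
    then show ?thesis by (simp add: sum.reindex[OF inj])
  qed
  moreover have "real (card ?A) = real k - real j"
    using assms by (simp add: card_image[OF inj] of_nat_diff)
  ultimately have "{\<omega> \<in> space instruction_space. \<bar>walk \<omega> p x k - walk \<omega> p x j\<bar> > H * sqrt (real k - real j)}
    \<subseteq> {\<omega> \<in> space instruction_space. \<bar>\<Sum>i\<in>?A. 1 * coin i \<omega>\<bar> \<ge> H * sqrt (real (card ?A))}"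
    by auto
  moreover have "{\<omega> \<in> space instruction_space. \<bar>\<Sum>i\<in>?A. 1 * coin i \<omega>\<bar> \<ge> H * sqrt (real (card ?A))}
      \<in> inst.events"
    using random_variable_X by measurable
  ultimately have "inst.prob {\<omega> \<in> space instruction_space. \<bar>walk \<omega> p x k - walk \<omega> p x j\<bar> > H * sqrt (real k - real j)}
      \<le> inst.prob {\<omega> \<in> space instruction_space. \<bar>\<Sum>i\<in>?A. 1 * coin i \<omega>\<bar> \<ge> H * sqrt (real (card ?A))}"
    by (rule inst.finite_measure_mono)
  also have "\<dots> \<le> 2 * exp (- (H\<^sup>2 / 2))"
    using assms by (intro hoeffding) auto
  finally show ?thesis .
qed

definition contrast_indices :: "int \<Rightarrow> nat \<Rightarrow> (particle \<times> int \<times> nat) set" where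
  "contrast_indices y v = {Oil, Water} \<times> {y - 1, y + 1} \<times> {1..v}"

definition contrast_sign :: "int \<Rightarrow> particle \<times> int \<times> nat \<Rightarrow> real" where
  "contrast_sign y = (\<lambda>(p, z, j). (if p = Oil then 1 else -1) * (if z = y - 1 then 1 else -1))"

lemma contrast_eq_sum:
  "contrast \<omega> y v = (\<Sum>i\<in>contrast_indices y v. contrast_sign y i * coin i \<omega>)"
  unfolding contrast_indices_def
  by (simp only: sum.cartesian_product')
    (simp add: contrast_sign_def contrast_def walk_def sum_negf)

lemma contrast_indices:
  "finite (contrast_indices y v)" "contrast_indices y v \<subseteq> instruction_indices"
  "card (contrast_indices y v) = 4 * v"
  by (auto simp: contrast_indices_def instruction_indices_def card_cartesian_product)

text \<open>A contrast is a sum of 4v signs, for which the threshold of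
  \<open>anti_concentration\<close> is the root of 4v/2.\<close>

lemma prob_contrast_small:
  assumes "v \<ge> 1"
  shows "inst.prob {\<omega> \<in> space instruction_space. \<bar>contrast \<omega> y v\<bar> < sqrt (2 * real v)} \<le> 9 / 10"
proof -
  interpret rademacher instruction_space "\<lambda>i \<omega>. contrast_sign y i * coin i \<omega>" "contrast_indices y v"
    by (rule rademacher_signed_coins) (use contrast_indices(2) in \<open>auto simp: contrast_indices(1) contrast_sign_def split: if_splits\<close>)
  have "contrast_indices y v \<noteq> {}" using contrast_indices(3)[of y v] assms by auto
  from anti_concentration[OF this] show ?thesis
    by (simp add: contrast_eq_sum contrast_indices)
qed

text \<open>Test sites four apart share no neighbour, so their contrasts are independent and the
  probabilities multiply.\<close>

lemma prob_no_separation: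
  assumes "v \<ge> 1" "b \<ge> 1"
  shows "inst.prob {\<omega> \<in> space instruction_space.
      \<forall>i<b. \<bar>contrast \<omega> (x + 1 + 4 * int i) v\<bar> < sqrt (2 * real v)} \<le> (9 / 10) ^ b"
proof -
  let ?y = "\<lambda>i. x + 1 + 4 * int i"
  let ?A = "\<lambda>i. contrast_indices (?y i) v"
  let ?U = "{z. \<bar>z\<bar> < sqrt (2 * real v)}"
  have disj: "disjoint_family_on ?A {..<b}"
  proof (unfold disjoint_family_on_def, intro ballI impI)
    fix i j :: nat assume "i \<noteq> j"
    then have "{?y i - 1, ?y i + 1} \<inter> {?y j - 1, ?y j + 1} = {}" by (simp; presburger)
    then show "?A i \<inter> ?A j = {}" unfolding contrast_indices_def by blast
  qed
  have "inst.indep_vars (\<lambda>j. Pi\<^sub>M (?A j) (\<lambda>_. borel))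
      (\<lambda>j \<omega>. restrict (\<lambda>i. coin i \<omega>) (?A j)) {..<b}"
    by (rule inst.indep_vars_restrict[OF indep_coins _ disj]) (simp add: contrast_indices)
  then have "inst.indep_vars (\<lambda>_. borel)
      (\<lambda>j \<omega>. \<Sum>i\<in>?A j. contrast_sign (?y j) i * restrict (\<lambda>i. coin i \<omega>) (?A j) i) {..<b}"
    by (rule inst.indep_vars_compose2) measurable
  then have ind: "inst.indep_vars (\<lambda>_. borel) (\<lambda>j \<omega>. contrast \<omega> (?y j) v) {..<b}"
    by (simp add: contrast_eq_sum[abs_def])
  have "inst.prob {\<omega> \<in> space instruction_space. \<forall>i<b. \<bar>contrast \<omega> (?y i) v\<bar> < sqrt (2 * real v)}
      = inst.prob (\<Inter>i\<in>{..<b}. (\<lambda>\<omega>. contrast \<omega> (?y i) v) -` ?U \<inter> space instruction_space)"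
    using assms(2) by (intro arg_cong[where f = inst.prob]) (auto simp: lessThan_empty_iff)
  also have "\<dots> = (\<Prod>i<b. inst.prob ((\<lambda>\<omega>. contrast \<omega> (?y i) v) -` ?U \<inter> space instruction_space))"
    using assms(2) by (intro inst.indep_varsD[OF ind]) (auto simp: lessThan_empty_iff)
  also have "\<dots> \<le> (\<Prod>i<b. 9 / 10)"
  proof (rule prod_mono)
    fix i assume "i \<in> {..<b}"
    have "(\<lambda>\<omega>. contrast \<omega> (?y i) v) -` ?U \<inter> space instruction_space
        = {\<omega> \<in> space instruction_space. \<bar>contrast \<omega> (?y i) v\<bar> < sqrt (2 * real v)}"
      by auto
    then show "0 \<le> inst.prob ((\<lambda>\<omega>. contrast \<omega> (?y i) v) -` ?U \<inter> space instruction_space) \<and>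
        inst.prob ((\<lambda>\<omega>. contrast \<omega> (?y i) v) -` ?U \<inter> space instruction_space) \<le> 9 / 10"
      using prob_contrast_small[OF assms(1)] by simp
  qed
  finally show ?thesis by simp
qed

lemma not_proper_null:
  "{\<omega> \<in> space instruction_space. \<not> proper \<omega>} \<in> inst.events"
  "inst.prob {\<omega> \<in> space instruction_space. \<not> proper \<omega>} = 0"
proof -
  have "countable instruction_indices"
  proof -
    have "(UNIV :: particle set) = {Oil, Water}" using particle.exhaust by auto
    then have "finite (UNIV :: particle set)" by (metis finite.emptyI finite.insertI)
    then have "countable (UNIV :: particle set)" by (rule countable_finite)
    then show ?thesis unfolding instruction_indices_def by (intro countable_SIGMA) auto
  qed
  have "inst.prob {\<omega> \<in> space instruction_space. \<omega> i \<in> {1, -1}} = 1"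
    if "i \<in> instruction_indices" for i
    by (subst prob_instruction[OF that]) simp
  then have "AE \<omega> in instruction_space. \<omega> i \<in> {1, -1}" if "i \<in> instruction_indices" for i
    using that inst.AE_prob_1 by (fastforce elim: AE_mp)
  then have ae: "AE \<omega> in instruction_space. proper \<omega>"
    unfolding proper_def by (subst AE_ball_countable[OF \<open>countable instruction_indices\<close>]) auto
  have eq: "{\<omega> \<in> space instruction_space. \<not> proper \<omega>}
    = (\<Union>i\<in>instruction_indices. space instruction_space - {\<omega> \<in> space instruction_space. \<omega> i \<in> {1, -1}})"
    by (auto simp: proper_def)
  show ev: "{\<omega> \<in> space instruction_space. \<not> proper \<omega>} \<in> inst.events"
    unfolding eq using \<open>countable instruction_indices\<close>
    by (intro sets.countable_UN' image_subsetI sets.compl_sets event_instruction)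
  show "inst.prob {\<omega> \<in> space instruction_space. \<not> proper \<omega>} = 0"
    using ae ev by (subst inst.prob_eq_0) (auto elim: eventually_mono)
qed

section \<open>The stopping time\<close>

text \<open>Makes the two displacements explicit arguments, so that averaging over one firing is a
  finite sum over four deterministic states.\<close>

definition outcome :: "int \<Rightarrow> int \<Rightarrow> int \<Rightarrow> state \<Rightarrow> state" where
  "outcome a c x s =
     \<lparr>num = (\<lambda>p y. num s p y - of_bool (y = x) + of_bool (y = x + (if p = Oil then a else c))),
      firings = (firings s)(x := Suc (firings s x))\<rparr>"

lemma fire_eq_outcome:
  "fire \<omega> x s = outcome (\<omega> (Oil, x, Suc (firings s x))) (\<omega> (Water, x, Suc (firings s x))) x s"
proof -
  have "p = Water" if "p \<noteq> Oil" for p using that by (cases p) auto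
  then show ?thesis by (auto simp: fire_def outcome_def fun_eq_iff)
qed

definition potential :: "int \<Rightarrow> state \<Rightarrow> real" where
  "potential L s = (\<Sum>x\<in>{-L..L}. (real (num s Oil x) - real (num s Water x))\<^sup>2)"

text \<open>Equal displacements change no surplus. The two opposite choices shift the surpluses at
  \<open>x + 1\<close> and \<open>x - 1\<close> by 1 with reversed signs, so the linear terms cancel
  and the squares add 4 in total, 1 on average.\<close>

lemma potential_outcomes:
  assumes "num s Oil x \<ge> 1" "num s Water x \<ge> 1" "\<bar>x\<bar> < L"
  shows "(\<Sum>a\<in>{1, -1}. \<Sum>c\<in>{1, -1}. potential L (outcome a c x s)) = 4 * potential L s + 4"
proof -
  define D where "D = (\<lambda>y. real (num s Oil y) - real (num s Water y))"
  define e :: "int \<Rightarrow> real" where "e = (\<lambda>y. of_bool (y = x + 1) - of_bool (y = x - 1))"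
  have D: "real (num (outcome a c x s) Oil y) - real (num (outcome a c x s) Water y)
      = D y + of_bool (y = x + a) - of_bool (y = x + c)" for a c y
    using assms by (auto simp: outcome_def D_def of_nat_diff)
  have "(\<Sum>a\<in>{1, -1}. \<Sum>c\<in>{1, -1}. potential L (outcome a c x s))
      = (\<Sum>y\<in>{-L..L}. (D y)\<^sup>2 + (D y)\<^sup>2 + (D y + e y)\<^sup>2 + (D y - e y)\<^sup>2)"
    unfolding potential_def D by (simp add: e_def sum.distrib algebra_simps flip: sum_distrib_left)
  also have "\<dots> = (\<Sum>y\<in>{-L..L}. 4 * (D y)\<^sup>2 + 2 * of_bool (y = x + 1) + 2 * of_bool (y = x - 1))"
    by (intro sum.cong) (auto simp: e_def power2_eq_square algebra_simps)
  also have "\<dots> = 4 * (\<Sum>y\<in>{-L..L}. (D y)\<^sup>2) + 4"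
  proof -
    have one: "(\<Sum>y\<in>{-L..L}. of_bool (y = z) :: real) = 1" if "z \<in> {-L..L}" for z
      using that by (simp add: of_bool_def)
    have "x + 1 \<in> {-L..L}" "x - 1 \<in> {-L..L}" using assms(3) by auto
    from this[THEN one] show ?thesis by (simp only: sum.distrib sum_distrib_left[symmetric])
  qed
  finally show ?thesis by (simp add: potential_def D_def)
qed

lemma sum_num_outcome:
  assumes "num s p x \<ge> 1" "\<bar>x\<bar> < L" "a \<in> {1, -1}" "c \<in> {1, -1}"
  shows "(\<Sum>y\<in>{-L..L}. num (outcome a c x s) p y) = (\<Sum>y\<in>{-L..L}. num s p y)"
proof -
  define z where "z = x + (if p = Oil then a else c)"
  have z: "x \<in> {-L..L}" "z \<in> {-L..L}" using assms by (auto simp: z_def)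
  \<comment> \<open>Adding the removed particle back on the left avoids truncated
    subtraction.\<close>
  have "(\<Sum>y\<in>{-L..L}. num (outcome a c x s) p y) + (\<Sum>y\<in>{-L..L}. of_bool (y = x))
      = (\<Sum>y\<in>{-L..L}. num s p y) + (\<Sum>y\<in>{-L..L}. of_bool (y = z))"
    unfolding sum.distrib[symmetric]
    by (intro sum.cong) (use assms(1) in \<open>auto simp: outcome_def z_def\<close>)
  moreover have "(\<Sum>y\<in>{-L..L}. of_bool (y = w) :: nat) = 1" if "w \<in> {-L..L}" for w
    using that by (simp add: of_bool_def)
  ultimately show ?thesis using z by simp
qed

text \<open>Each surplus is at most the number of particles at its site, hence at most 2n, and these
  numbers add up to 2n.\<close>

lemma potential_bounds:
  assumes "\<And>p. (\<Sum>y\<in>{-L..L}. num s p y) = n"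
  shows "0 \<le> potential L s" "potential L s \<le> 4 * (real n)\<^sup>2"
proof -
  let ?D = "\<lambda>y. real (num s Oil y) - real (num s Water y)"
  show "0 \<le> potential L s" by (simp add: potential_def sum_nonneg)
  have sum: "(\<Sum>y\<in>{-L..L}. real (num s Oil y) + real (num s Water y)) = 2 * real n"
    using assms by (simp add: sum.distrib flip: of_nat_sum)
  have D: "\<bar>?D y\<bar> \<le> real (num s Oil y) + real (num s Water y)" for y by simp
  have "potential L s \<le> (\<Sum>y\<in>{-L..L}. (real (num s Oil y) + real (num s Water y)) * (2 * real n))"
    unfolding potential_def
  proof (rule sum_mono)
    fix y assume y: "y \<in> {-L..L}"
    have "real (num s Oil y) + real (num s Water y) \<le> 2 * real n"
      unfolding sum[symmetric] using y by (intro member_le_sum) auto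
    then have "\<bar>?D y\<bar> * \<bar>?D y\<bar> \<le> (real (num s Oil y) + real (num s Water y)) * (2 * real n)"
      using D[of y] by (intro mult_mono) auto
    then show "(?D y)\<^sup>2 \<le> (real (num s Oil y) + real (num s Water y)) * (2 * real n)"
      by (simp add: power2_eq_square abs_mult_self_eq)
  qed
  also have "\<dots> = 4 * (real n)\<^sup>2"
    unfolding sum_distrib_right[symmetric] sum by (simp add: power2_eq_square)
  finally show "potential L s \<le> 4 * (real n)\<^sup>2" .
qed

text \<open>
  The survival bound is proved on cylinders fixing the finitely many instructions \<open>F\<close> already
  read, so that the induction over time needs no conditional expectation. Since the potential is
  at most \<open>4 n\<^sup>2\<close> but grows by 1 on average with each firing, \<open>8 n\<^sup>2 - potential\<close>
  decreases on average by the factor \<open>1 - 1 / (8 n\<^sup>2)\<close>.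
\<close>

lemma survival_on_cylinder:
  assumes "n \<ge> 1" "finite F" "F \<subseteq> instruction_indices" "\<And>i. i \<in> F \<Longrightarrow> c i \<in> {1, -1}"
    and "\<And>p x k. (p, x, k) \<in> F \<Longrightarrow> k \<le> firings s x"
    and "\<And>p x. \<bar>x\<bar> > int m \<Longrightarrow> num s p x = 0"
    and "int m + int t \<le> L"
    and "\<And>p. (\<Sum>y\<in>{-L..L}. num s p y) = n"
  shows "\<exists>B\<in>inst.events.
    {\<omega> \<in> space instruction_space. proper \<omega> \<and> (\<forall>i\<in>F. \<omega> i = c i) \<and> active ((step \<omega> ^^ t) s) \<noteq> {}} \<subseteq> B \<and>
    inst.prob B \<le> (1 / 2) ^ card F * (1 - 1 / (8 * (real n)\<^sup>2)) ^ t
      * ((8 * (real n)\<^sup>2 - potential L s) / (4 * (real n)\<^sup>2))"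
  using assms(2-)
proof (induction t arbitrary: F c s m)
  case 0
  let ?B = "{\<omega> \<in> space instruction_space. \<forall>i\<in>F. \<omega> i = c i}"
  \<comment> \<open>The potential is at most 4n^2, so the last factor is at least 1 and the cylinder
    itself serves as covering event.\<close>
  have "1 \<le> (8 * (real n)\<^sup>2 - potential L s) / (4 * (real n)\<^sup>2)"
    using potential_bounds[of s L n] 0 assms(1) by (simp add: field_simps)
  then have "(1 / 2) ^ card F * 1 \<le>
      (1 / 2) ^ card F * ((8 * (real n)\<^sup>2 - potential L s) / (4 * (real n)\<^sup>2))"
    by (intro mult_left_mono) auto
  then show ?case
    using prob_cylinder[OF 0(1-3)] by (intro bexI[of _ ?B]) auto
next
  case (Suc t)
  define \<rho> where "\<rho> = 1 - 1 / (8 * (real n)\<^sup>2)"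
  define h where "h s = (8 * (real n)\<^sup>2 - potential L s) / (4 * (real n)\<^sup>2)" for s
  have n2: "(real n)\<^sup>2 \<ge> 1" using assms(1) by simp
  then have "1 / (8 * (real n)\<^sup>2) \<le> 1 / 1" by (intro divide_left_mono) linarith+
  then have \<rho>: "0 \<le> \<rho>" by (simp add: \<rho>_def)
  have "\<bar>x\<bar> \<le> int m" if "x \<in> active s" for x
    using that Suc.prems(5)[of x Oil] by (force simp: active_def)
  then have "active s \<subseteq> {- int m..int m}" by fastforce
  then have fin: "finite (active s)" by (rule finite_subset) simp
  show ?case
  proof (cases "active s = {}")
    case True
    then have "(step \<omega> ^^ k) s = s" for \<omega> k by (induction k) (auto simp: step_def)
    moreover have "0 \<le> h s"
      using potential_bounds[of s L n] Suc.prems(7) n2 by (simp add: h_def)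
    moreover have "0 \<le> (1 / 2) ^ card F * \<rho> ^ Suc t * h s"
      using \<open>0 \<le> h s\<close> \<rho> by simp
    ultimately show ?thesis
      using True unfolding h_def \<rho>_def
      by (intro bexI[of _ "{}"]) (auto simp del: funpow.simps)
  next
    case False
    define x where "x = Min (active s)"
    have pos: "num s p x \<ge> 1" for p
      unfolding x_def by (rule Min_active[OF fin False])
    have x: "\<bar>x\<bar> \<le> int m"
      using Suc.prems(5)[of x Oil] pos[of Oil] by (cases "\<bar>x\<bar> \<le> int m") auto
    define i j where "i = (Oil, x, Suc (firings s x))" and "j = (Water, x, Suc (firings s x))"
    \<comment> \<open>By the bound on the indices in \<open>F\<close>, the next two instructions at
      \<open>x\<close> are still unread; fixing them as well refines the cylinder.\<close>
    have ij: "i \<notin> F" "j \<notin> F" "i \<noteq> j" "i \<in> instruction_indices" "j \<in> instruction_indices"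
      using Suc.prems(4) by (fastforce simp: i_def j_def instruction_indices_def)+
    define F' where "F' = insert i (insert j F)"
    have F': "finite F'" "card F' = Suc (Suc (card F))"
      using ij Suc.prems(1) by (auto simp: F'_def)
    define survivors where "survivors a d = {\<omega> \<in> space instruction_space. proper \<omega> \<and>
      (\<forall>k\<in>F'. \<omega> k = (c(i := a, j := d)) k) \<and> active ((step \<omega> ^^ t) (outcome a d x s)) \<noteq> {}}" for a d
    define bound where "bound a d = (1 / 2) ^ card F' * \<rho> ^ t * h (outcome a d x s)" for a d
    \<comment> \<open>Survivors are covered by an event, which spares a measurability proof for the
      process. The support bound \<open>m\<close> grows by one while \<open>t\<close> drops by one,
      so the window \<open>L\<close> stays large enough.\<close>
    have "\<exists>B. B \<in> inst.events \<and> survivors a d \<subseteq> B \<and> inst.prob B \<le> bound a d"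
      if ad: "a \<in> {1, -1}" "d \<in> {1, -1}" for a d
      unfolding \<rho>_def h_def survivors_def bound_def Bex_def[symmetric]
    proof (rule Suc.IH)
      show "F' \<subseteq> instruction_indices" using ij Suc.prems(2) by (simp add: F'_def)
      show "(c(i := a, j := d)) k \<in> {1, -1}" if "k \<in> F'" for k
        using that ad Suc.prems(3)[of k] by (cases "k = i"; cases "k = j") (simp_all add: F'_def)
      show "k \<le> firings (outcome a d x s) y" if "(p, y, k) \<in> F'" for p y k
      proof -
        from that have "(p, y, k) = i \<or> (p, y, k) = j \<or> k \<le> firings s y"
          using Suc.prems(4)[of p y k] by (auto simp only: F'_def)
        then show ?thesis by (auto simp: i_def j_def outcome_def)
      qed
      show "num (outcome a d x s) p y = 0" if "\<bar>y\<bar> > int (Suc m)" for p y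
        using that x ad Suc.prems(5)[of y p] by (auto simp: outcome_def)
      show "int (Suc m) + int t \<le> L" using Suc.prems(6) by simp
      show "(\<Sum>y\<in>{-L..L}. num (outcome a d x s) p y) = n" for p
        using sum_num_outcome[OF pos _ ad] x Suc.prems(6,7) by simp
    qed (rule F'(1))
    then obtain B where B: "\<And>a d. a \<in> {1, -1} \<Longrightarrow> d \<in> {1, -1} \<Longrightarrow> B a d \<in> inst.events"
      "\<And>a d. a \<in> {1, -1} \<Longrightarrow> d \<in> {1, -1} \<Longrightarrow> survivors a d \<subseteq> B a d"
      "\<And>a d. a \<in> {1, -1} \<Longrightarrow> d \<in> {1, -1} \<Longrightarrow> inst.prob (B a d) \<le> bound a d"
      by metis
    let ?B = "\<Union>a\<in>{1, -1}. \<Union>d\<in>{1, -1}. B a d"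
    have "{\<omega> \<in> space instruction_space. proper \<omega> \<and> (\<forall>i\<in>F. \<omega> i = c i)
        \<and> active ((step \<omega> ^^ Suc t) s) \<noteq> {}} \<subseteq> ?B"
    proof
      fix \<omega>
      assume \<omega>: "\<omega> \<in> {\<omega> \<in> space instruction_space. proper \<omega> \<and> (\<forall>i\<in>F. \<omega> i = c i)
        \<and> active ((step \<omega> ^^ Suc t) s) \<noteq> {}}"
      then have "\<omega> i \<in> {1, -1}" "\<omega> j \<in> {1, -1}" using ij by (auto simp: proper_def)
      moreover have "step \<omega> s = outcome (\<omega> i) (\<omega> j) x s"
        using False by (simp add: step_def x_def i_def j_def fire_eq_outcome)
      moreover have "\<forall>k\<in>F'. \<omega> k = (c(i := \<omega> i, j := \<omega> j)) k"
        using \<omega> by (auto simp: F'_def)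
      ultimately have "\<omega> \<in> B (\<omega> i) (\<omega> j)"
        using \<omega> B(2)[of "\<omega> i" "\<omega> j"]
        by (auto simp: survivors_def funpow_Suc_right simp del: funpow.simps)
      then show "\<omega> \<in> ?B" using \<open>\<omega> i \<in> {1, -1}\<close> \<open>\<omega> j \<in> {1, -1}\<close> by blast
    qed
    moreover have "inst.prob ?B \<le> (1 / 2) ^ card F * \<rho> ^ Suc t * h s"
    proof -
      have h: "h s = 2 - potential L s / (4 * (real n)\<^sup>2)" for s
        using assms(1) by (simp add: h_def diff_divide_distrib)
      have pot: "(\<Sum>a\<in>{1, -1}. \<Sum>d\<in>{1, -1}. potential L (outcome a d x s)) = 4 * potential L s + 4"
        using x Suc.prems(6) by (intro potential_outcomes pos) simp
      have "(\<Sum>a\<in>{1, -1}. \<Sum>d\<in>{1, -1}. h (outcome a d x s))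
          = 8 - (\<Sum>a\<in>{1, -1}. \<Sum>d\<in>{1, -1}. potential L (outcome a d x s)) / (4 * (real n)\<^sup>2)"
        unfolding h by (simp add: add_divide_distrib)
      also have "\<dots> = 4 * h s - 1 / (real n)\<^sup>2"
        unfolding pot h by (simp add: add_divide_distrib)
      \<comment> \<open>As \<open>h s \<le> 2\<close>, the loss 1/n^2 is at least
        \<open>4 * (1 - \<rho>) * h s\<close>.\<close>
      also have "\<dots> \<le> 4 * (\<rho> * h s)"
      proof -
        have "h s \<le> 2"
          using potential_bounds[of s L n] Suc.prems(7) n2 by (simp add: h)
        then have "h s / (2 * (real n)\<^sup>2) \<le> 2 / (2 * (real n)\<^sup>2)"
          by (rule divide_right_mono) simp
        moreover have "4 * (\<rho> * h s) = 4 * h s - h s / (2 * (real n)\<^sup>2)"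
          by (simp add: \<rho>_def left_diff_distrib)
        ultimately show ?thesis by simp
      qed
      finally have sum_h: "(\<Sum>a\<in>{1, -1}. \<Sum>d\<in>{1, -1}. h (outcome a d x s)) \<le> 4 * (\<rho> * h s)" .
      have "inst.prob ?B \<le> (\<Sum>a\<in>{1, -1}. inst.prob (\<Union>d\<in>{1, -1}. B a d))"
        using B(1) by (intro measure_UNION_le sets.finite_UN) auto
      also have "\<dots> \<le> (\<Sum>a\<in>{1, -1}. \<Sum>d\<in>{1, -1}. inst.prob (B a d))"
        using B(1) by (intro sum_mono measure_UNION_le) auto
      also have "\<dots> \<le> (\<Sum>a\<in>{1, -1}. \<Sum>d\<in>{1, -1}. bound a d)"
        by (intro sum_mono B(3))
      also have "\<dots> = (1 / 2) ^ card F' * \<rho> ^ t *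
          (\<Sum>a\<in>{1, -1}. \<Sum>d\<in>{1, -1}. h (outcome a d x s))"
        by (simp only: bound_def sum_distrib_left)
      also have "\<dots> \<le> (1 / 2) ^ card F' * \<rho> ^ t * (4 * (\<rho> * h s))"
        using \<rho> by (intro mult_left_mono sum_h) simp
      \<comment> \<open>The two coordinates added to \<open>F\<close> give the factor 1/4 that
        cancels the 4.\<close>
      also have "\<dots> = (1 / 2) ^ card F * \<rho> ^ Suc t * h s"
        by (simp add: F'(2))
      finally show ?thesis .
    qed
    moreover have "?B \<in> inst.events" using B(1) by (intro sets.finite_UN) auto
    ultimately show ?thesis unfolding \<rho>_def h_def by blast
  qed
qed

text \<open>The case of the empty cylinder; the initial potential is 0, whence the factor 8n^2 /
  (4n^2) = 2.\<close>

lemma survival: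
  assumes "n \<ge> 1"
  shows "\<exists>B\<in>inst.events.
    {\<omega> \<in> space instruction_space. proper \<omega> \<and> active (state_at n \<omega> T) \<noteq> {}} \<subseteq> B \<and>
    inst.prob B \<le> 2 * (1 - 1 / (8 * (real n)\<^sup>2)) ^ T"
proof -
  have "potential (int T) (initial n) = 0"
    by (simp add: potential_def initial_def)
  then show ?thesis
    using survival_on_cylinder[OF assms, of "{}" undefined "initial n" 0 T "int T"] assms
    by (simp add: state_at_def initial_def sum.If_cases power2_eq_square mult.commute)
qed

section \<open>Typical runs are probable\<close>

text \<open>A union bound over improper instructions, survival up to \<open>T\<close>, and failures
  of oscillation or separation, the last two over finitely many sites and times.\<close>

lemma typical_run_probable:
  assumes "n \<ge> 1" "b \<ge> 1" "H \<ge> 1"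
  shows "\<exists>B\<in>inst.events.
    (\<forall>\<omega>\<in>space instruction_space - B. typical_run T b \<omega> H \<and> active (state_at n \<omega> T) = {}) \<and>
    inst.prob B \<le> 2 * (1 - 1 / (8 * (real n)\<^sup>2)) ^ T
      + (2 * real T + 1) * (real T + 1) ^ 2 * (4 * exp (- (H\<^sup>2 / 2)))
      + (2 * real T + 1) * real T * (9 / 10) ^ b"
proof -
  obtain B\<^sub>1 where B1: "B\<^sub>1 \<in> inst.events"
    "{\<omega> \<in> space instruction_space. proper \<omega> \<and> active (state_at n \<omega> T) \<noteq> {}} \<subseteq> B\<^sub>1"
    "inst.prob B\<^sub>1 \<le> 2 * (1 - 1 / (8 * (real n)\<^sup>2)) ^ T"
    using survival[OF assms(1)] by blast
  let ?N = "{\<omega> \<in> space instruction_space. \<not> proper \<omega>}"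
  let ?osc = "\<lambda>(p, x, j, k). {\<omega> \<in> space instruction_space.
    j < k \<and> \<bar>walk \<omega> p x k - walk \<omega> p x j\<bar> > H * sqrt (real k - real j)}"
  let ?sep = "\<lambda>(x, v). {\<omega> \<in> space instruction_space.
    \<forall>i<b. \<bar>contrast \<omega> (x + 1 + 4 * int i) v\<bar> < sqrt (2 * real v)}"
  let ?I = "{Oil, Water} \<times> {- int T..int T} \<times> {0..T} \<times> {0..T}"
  let ?J = "{- int T..int T} \<times> {1..T}"
  let ?B\<^sub>2 = "\<Union>i\<in>?I. ?osc i" and ?B\<^sub>3 = "\<Union>i\<in>?J. ?sep i"
  have osc: "?osc i \<in> inst.events" for i by (cases i) simp
  have sep: "?sep i \<in> inst.events" for i by (cases i) simp
  have B2: "?B\<^sub>2 \<in> inst.events" using osc by (intro sets.finite_UN) auto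
  have B3: "?B\<^sub>3 \<in> inst.events" using sep by (intro sets.finite_UN) auto
  have card_I: "real (card ?I) = 2 * (2 * real T + 1) * (real T + 1) ^ 2"
    by (simp add: card_cartesian_product power2_eq_square algebra_simps)
  have card_J: "real (card ?J) = (2 * real T + 1) * real T"
    by (simp add: card_cartesian_product algebra_simps)
  have "inst.prob ?B\<^sub>2 \<le> (\<Sum>i\<in>?I. inst.prob (?osc i))"
    using osc by (intro measure_UNION_le) auto
  also have "\<dots> \<le> (\<Sum>i\<in>?I. 2 * exp (- (H\<^sup>2 / 2)))"
  proof (rule sum_mono)
    fix i assume "i \<in> ?I"
    obtain p x j k where i: "i = (p, x, j, k)" by (cases i)
    show "inst.prob (?osc i) \<le> 2 * exp (- (H\<^sup>2 / 2))"
      using prob_oscillation[of j k H p x] assms(3) by (cases "j < k") (simp_all add: i)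
  qed
  also have "\<dots> = real (card ?I) * (2 * exp (- (H\<^sup>2 / 2)))" by (simp only: sum_constant)
  finally have P2: "inst.prob ?B\<^sub>2 \<le> (2 * real T + 1) * (real T + 1) ^ 2 * (4 * exp (- (H\<^sup>2 / 2)))"
    unfolding card_I by (simp add: algebra_simps)
  have "inst.prob ?B\<^sub>3 \<le> (\<Sum>i\<in>?J. inst.prob (?sep i))"
    using sep by (intro measure_UNION_le) auto
  also have "\<dots> \<le> (\<Sum>i\<in>?J. (9 / 10) ^ b)"
    by (intro sum_mono) (use prob_no_separation[OF _ assms(2)] in auto)
  also have "\<dots> = real (card ?J) * (9 / 10) ^ b" by (simp only: sum_constant)
  finally have P3: "inst.prob ?B\<^sub>3 \<le> (2 * real T + 1) * real T * (9 / 10) ^ b"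
    unfolding card_J .
  define B where "B = ?N \<union> (B\<^sub>1 \<union> (?B\<^sub>2 \<union> ?B\<^sub>3))"
  have "B \<in> inst.events"
    unfolding B_def by (intro sets.Un not_proper_null(1) B1(1) B2 B3)
  moreover have "inst.prob B \<le> inst.prob ?N + (inst.prob B\<^sub>1 + (inst.prob ?B\<^sub>2 + inst.prob ?B\<^sub>3))"
    unfolding B_def
    by (intro order_trans[OF measure_Un_le] add_left_mono sets.Un
        not_proper_null(1) B1(1) B2 B3 order_refl)
  moreover have "typical_run T b \<omega> H \<and> active (state_at n \<omega> T) = {}"
    if \<omega>: "\<omega> \<in> space instruction_space - B" for \<omega>
  proof
    have "proper \<omega>" using \<omega> by (auto simp: B_def)
    then show "active (state_at n \<omega> T) = {}" using \<omega> B1(2) by (auto simp: B_def)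
    show "typical_run T b \<omega> H"
    proof
      show "proper \<omega>" "H \<ge> 1" by fact+
      show "\<bar>walk \<omega> p x k - walk \<omega> p x j\<bar> \<le> H * sqrt (real k - real j)"
        if "\<bar>x\<bar> \<le> int T" "j \<le> k" "k \<le> T" for p x j k
      proof (cases "j = k")
        case False
        have "(p, x, j, k) \<in> ?I" using that by (cases p) auto
        then have "\<omega> \<notin> ?osc (p, x, j, k)" using \<omega> unfolding B_def by blast
        then show ?thesis using \<omega> that False by auto
      qed simp
      show "\<exists>i<b. \<bar>contrast \<omega> (x + 1 + 4 * int i) v\<bar> \<ge> sqrt (2 * real v)"
        if "\<bar>x\<bar> \<le> int T" "1 \<le> v" "v \<le> T" for x v
      proof -
        have "(x, v) \<in> ?J" using that by auto
        then have "\<omega> \<notin> ?sep (x, v)" using \<omega> unfolding B_def by blast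
        then show ?thesis using \<omega> by (auto simp: not_less)
      qed
    qed
  qed
  ultimately show ?thesis
    using P2 P3 B1(3) not_proper_null(2) by (intro bexI[of _ B]) auto
qed

section \<open>Asymptotics and the choice of parameters\<close>

lemma failure_bound_asymp:
  fixes e :: real
  assumes "0 < e" "e < 1 / 20"
  shows "\<forall>\<^sub>F x::real in at_top. 2 * exp (- x / 8)
      + (2 * x ^ 3 + 1) * (x ^ 3 + 1) ^ 2 * (4 * exp (- ((x powr e)\<^sup>2 / 2)))
      + (2 * x ^ 3 + 1) * x ^ 3 * exp (- ((x powr e - 1) / 10)) < exp (- (x powr (e / 2)))"
  using assms by real_asymp

text \<open>Comparing exponents, the conditions amount to 2e < 1/4, e + 3/4 < 1 - e/2, 1/3 + 7e/8 <
  1/3 + e, 1 + 3e < 4/3 + e/2 and 2 < 2 + e/4. The additive constants absorb rounding.\<close>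

lemma scale_conditions_asymp:
  fixes e :: real
  assumes "0 < e" "e < 1 / 20"
  shows
    "\<forall>\<^sub>F x::real in at_top. x powr (1 / 4) \<ge> 1024 * (x powr e)\<^sup>2"
    "\<forall>\<^sub>F x::real in at_top. 8 * x powr e * x powr (3 / 4) \<le> x powr (1 - e / 2)"
    "\<forall>\<^sub>F x::real in at_top.
      (x powr (1 / 3 - e / 8) + 1) * (4 * x powr e) \<le> x powr (1 / 3 + e) / 2 - 2"
    "\<forall>\<^sub>F x::real in at_top.
      4096 * (x powr e) ^ 3 * x \<le> (x powr (1 / 3 + e) - 1) * x powr (1 - e / 2)"
    "\<forall>\<^sub>F x::real in at_top.
      (16 * x)\<^sup>2 < (x powr (1 / 3 - e / 8))\<^sup>2 * ((x powr (1 / 3 + e) - 1) * x powr (1 - e / 2))"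
  using assms by real_asymp+

text \<open>About n^(1/3 - e/8) blocks are few enough to fit into half of the interval up to
  \<open>R\<close>, yet many enough to exceed 2n particles in \<open>num_outside_le\<close>.\<close>

lemma typical_run_imp_num_outside_le:
  fixes n :: nat and e :: real
  defines "x \<equiv> real n"
  assumes "n \<ge> 1" "e > 0"
    and c: "x powr (1 / 4) \<ge> 1024 * (x powr e)\<^sup>2"
      "8 * x powr e * x powr (3 / 4) \<le> x powr (1 - e / 2)"
      "(x powr (1 / 3 - e / 8) + 1) * (4 * x powr e) \<le> x powr (1 / 3 + e) / 2 - 2"
      "4096 * (x powr e) ^ 3 * x \<le> (x powr (1 / 3 + e) - 1) * x powr (1 - e / 2)"
      "(16 * x)\<^sup>2 < (x powr (1 / 3 - e / 8))\<^sup>2 * ((x powr (1 / 3 + e) - 1) * x powr (1 - e / 2))"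
    and run: "typical_run T (nat \<lfloor>x powr e\<rfloor>) \<omega> (x powr e)"
    and stopped: "active (state_at n \<omega> T) = {}"
  shows "num_outside n (x powr (1 / 3 + e)) \<omega> \<le> x powr (1 - e / 2)"
proof -
  define H where "H = x powr e"
  define b where "b = nat \<lfloor>H\<rfloor>"
  define r where "r = x powr (1 / 3 + e)"
  define R where "R = nat \<lfloor>r\<rfloor>"
  define M where "M = x powr (1 - e / 2)"
  define p where "p = x powr (1 / 3 - e / 8)"
  define m where "m = nat \<lceil>p\<rceil>"
  interpret typical_run n T b \<omega> H
    using run by (simp add: b_def H_def)
  have x: "x \<ge> 1" using assms(2) by (simp add: x_def)
  have pos: "M > 0" "p > 0" "r > 0" using x by (auto simp: M_def p_def r_def)
  have b: "b > 0" "real b \<le> H" using H_ge_1 by (auto simp: b_def le_nat_floor)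
  have m: "m > 0" "p \<le> real m" "real m \<le> p + 1"
    using pos(2) unfolding m_def by linarith+
  have R: "r - 1 \<le> real R" using pos(3) unfolding R_def by linarith
  have "real (m * (4 * b)) \<le> (p + 1) * (4 * H)"
    using m b pos by (simp add: mult_mono)
  \<comment> \<open>Replacing \<open>r\<close> by its floor costs at most 1/2 here; the spare 1
    makes up for the rounding in \<open>R div 2\<close>.\<close>
  also have "\<dots> \<le> real R / 2 - 1"
    using c(3) R unfolding p_def H_def r_def by linarith
  finally have mR: "m * (4 * b) \<le> R div 2" by linarith
  then have R_pos: "R > 0" using m(1) b(1) by (cases "R = 0") auto
  have RM: "(r - 1) * M \<le> real R * M" using R pos by (intro mult_right_mono) auto
  have mR_large: "16 * real n < real m * sqrt (real R * M)"
  proof (rule power2_less_imp_less)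
    have "(16 * real n)\<^sup>2 < p\<^sup>2 * ((r - 1) * M)"
      using c(5) by (simp add: p_def r_def M_def x_def)
    also have "\<dots> \<le> (real m)\<^sup>2 * ((r - 1) * M)"
    proof (rule mult_right_mono)
      have "0 \<le> 4096 * (x powr e) ^ 3 * x" using x by simp
      then show "0 \<le> (r - 1) * M" using c(4) unfolding r_def M_def by linarith
    qed (use m pos in \<open>auto intro: power_mono\<close>)
    also have "\<dots> \<le> (real m)\<^sup>2 * (real R * M)"
      by (rule mult_left_mono) (fact RM, simp)
    also have "\<dots> = (real m * sqrt (real R * M))\<^sup>2"
      using pos by (simp add: power_mult_distrib)
    finally show "(16 * real n)\<^sup>2 < (real m * sqrt (real R * M))\<^sup>2" .
  qed (use pos in simp)
  have "num_outside n r \<omega> \<le> M"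
  proof (rule num_outside_le[where g = "x powr (1 / 4)" and R = R and m = m])
    show "real n = (x powr (1 / 4)) ^ 4" using x by (simp add: x_def powr_power)
    show "1024 * H\<^sup>2 \<le> x powr (1 / 4)" using c(1) by (simp add: H_def)
    have "(x powr (1 / 4)) ^ 3 = x powr (3 / 4)" using x by (simp add: powr_power)
    then show "8 * H * (x powr (1 / 4)) ^ 3 \<le> M" using c(2) by (simp add: H_def M_def)
    show "4096 * H ^ 3 * real n \<le> real R * M"
      using c(4) RM unfolding H_def r_def M_def x_def by linarith
    show "active final = {}" using stopped by (simp add: final_def)
  qed (fact b pos R_pos mR mR_large R_def)+
  then show ?thesis by (simp add: r_def M_def)
qed

theorem theorem1p2:
  "\<exists>\<epsilon>\<^sub>0::real. \<epsilon>\<^sub>0 > 0 \<and> (\<forall>\<epsilon>::real. 0 < \<epsilon> \<and> \<epsilon> < \<epsilon>\<^sub>0 \<longrightarrow>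
     (\<exists>\<delta>::real. \<delta> > 0 \<and> (\<forall>\<^sub>F n::nat in sequentially.
        measure instruction_space
          {\<omega> \<in> space instruction_space.
             num_outside n (real n powr (1 / 3 + \<epsilon>)) \<omega> > real n powr (1 - \<epsilon> / 2)}
          < exp (- (real n powr \<delta>)))))"
proof (rule exI[of _ "1 / 20"], intro conjI allI impI)
  fix e :: real
  assume "0 < e \<and> e < 1 / 20"
  then have e: "0 < e" "e < 1 / 20" by auto
  note ev = failure_bound_asymp[OF e] scale_conditions_asymp[OF e]
  \<comment> \<open>The slowest decay in the failure bound is exp(-n^e / 10); the choice of e/2 for
    \<delta> absorbs the constant and the polynomial factors.\<close>
  have "\<forall>\<^sub>F n::nat in sequentially.
        measure instruction_space
          {\<omega> \<in> space instruction_space.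
             num_outside n (real n powr (1 / 3 + e)) \<omega> > real n powr (1 - e / 2)}
          < exp (- (real n powr (e / 2)))"
    using ev[THEN eventually_compose_filterlim, OF filterlim_real_sequentially]
      eventually_ge_at_top[of 1]
  proof eventually_elim
    case (elim n)
    define H where "H = real n powr e"
    define b where "b = nat \<lfloor>H\<rfloor>"
    have H: "H \<ge> 1" using elim(7) e by (simp add: H_def ge_one_powr_ge_zero)
    then have b: "b \<ge> 1" "real b \<ge> H - 1" unfolding b_def by linarith+
    let ?E = "{\<omega> \<in> space instruction_space.
             num_outside n (real n powr (1 / 3 + e)) \<omega> > real n powr (1 - e / 2)}"
    obtain B where B: "B \<in> inst.events"
      "\<And>\<omega>. \<omega> \<in> space instruction_space - B \<Longrightarrow>
        typical_run (n ^ 3) b \<omega> H \<and> active (state_at n \<omega> (n ^ 3)) = {}"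
      "inst.prob B \<le> 2 * (1 - 1 / (8 * (real n)\<^sup>2)) ^ (n ^ 3)
      + (2 * real (n ^ 3) + 1) * (real (n ^ 3) + 1) ^ 2 * (4 * exp (- (H\<^sup>2 / 2)))
      + (2 * real (n ^ 3) + 1) * real (n ^ 3) * (9 / 10) ^ b"
      using typical_run_probable[OF elim(7) b(1) H, of "n ^ 3"] by blast
    have "num_outside n (real n powr (1 / 3 + e)) \<omega> \<le> real n powr (1 - e / 2)"
      if "\<omega> \<in> space instruction_space - B" for \<omega>
      using typical_run_imp_num_outside_le[OF elim(7) e(1) elim(2-6)]
        B(2)[OF that, unfolded b_def H_def] by blast
    then have "?E \<subseteq> B" by (auto simp: not_less[symmetric])
    then have mono: "inst.prob ?E \<le> inst.prob B"
      using B(1) by (rule inst.finite_measure_mono)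
    \<comment> \<open>The time \<open>n ^ 3\<close> against the rate 1/(8n^2) yields the exponent
      n/8.\<close>
    have surv: "(1 - 1 / (8 * (real n)\<^sup>2)) ^ (n ^ 3) \<le> exp (- real n / 8)"
    proof -
      have "(1 - 1 / (8 * (real n)\<^sup>2)) ^ (n ^ 3) \<le> exp (- (1 / (8 * (real n)\<^sup>2))) ^ (n ^ 3)"
      proof (rule power_mono)
        have "(real n)\<^sup>2 \<ge> 1" using elim(7) by simp
        then have "1 / (8 * (real n)\<^sup>2) \<le> 1 / 1" by (intro divide_left_mono) linarith+
        then show "0 \<le> 1 - 1 / (8 * (real n)\<^sup>2)" by simp
        show "1 - 1 / (8 * (real n)\<^sup>2) \<le> exp (- (1 / (8 * (real n)\<^sup>2)))"
          using exp_ge_add_one_self[of "- (1 / (8 * (real n)\<^sup>2))"] by simp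
      qed
      also have "\<dots> = exp (- real n / 8)"
        using elim(7) by (simp add: exp_of_nat_mult[symmetric] power2_eq_square power3_eq_cube)
      finally show ?thesis .
    qed
    have sep: "(9 / 10 :: real) ^ b \<le> exp (- ((H - 1) / 10))"
    proof -
      have "(9 / 10 :: real) ^ b \<le> exp (- (1 / 10)) ^ b"
        using exp_ge_add_one_self[of "- (1 / 10) :: real"] by (intro power_mono) auto
      also have "\<dots> = exp (- (real b / 10))" by (simp add: exp_of_nat_mult[symmetric])
      also have "\<dots> \<le> exp (- ((H - 1) / 10))" using b(2) by simp
      finally show ?thesis .
    qed
    note mono
    also note B(3)
    also have "2 * (1 - 1 / (8 * (real n)\<^sup>2)) ^ (n ^ 3)
      + (2 * real (n ^ 3) + 1) * (real (n ^ 3) + 1) ^ 2 * (4 * exp (- (H\<^sup>2 / 2)))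
      + (2 * real (n ^ 3) + 1) * real (n ^ 3) * (9 / 10) ^ b
      \<le> 2 * exp (- real n / 8)
      + (2 * real (n ^ 3) + 1) * (real (n ^ 3) + 1) ^ 2 * (4 * exp (- (H\<^sup>2 / 2)))
      + (2 * real (n ^ 3) + 1) * real (n ^ 3) * exp (- ((H - 1) / 10))"
      by (intro add_mono mult_left_mono surv sep order_refl) auto
    also have "\<dots> < exp (- (real n powr (e / 2)))"
      using elim(1) by (simp add: H_def)
    finally show ?case .
  qed
  then show "\<exists>\<delta>::real. \<delta> > 0 \<and> (\<forall>\<^sub>F n::nat in sequentially.
        measure instruction_space
          {\<omega> \<in> space instruction_space.
             num_outside n (real n powr (1 / 3 + e)) \<omega> > real n powr (1 - e / 2)}
          < exp (- (real n powr \<delta>)))"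
    using e by (intro exI[of _ "e / 2"]) simp
qed simp

end
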